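(* Let $q>0$ be an integer, let $X$ be an infinite $(q+1)$-regular graph, fix a base vertex $x_0$ of $X$, and let $x$ be any vertex of $X$. Define the two-variable zeta function by $$\log\zeta_X(u,x)=\sum_{m=1}^\infty\frac{b_m(x)}{m}u^m .$$ Then, for all $u$ with $|u|$ sufficiently small, $$-\log\zeta_X(u,x)=\int\log\bigl(1-(q+1-\lambda)u+qu^2\bigr)\,d\mu_x(\lambda),$$ where $\mu_x$ is the spectral measure associated with $x_0$ and $x$.
   Context: A graph $X$ consists of a set $VX$ of vertices, a set $EX$ of (oriented) edges, maps $o,t:EX\to VX$ (origin and terminus), and a map $y\mapsto\overline{y}$ on $EX$ with $\overline{\overline{y}}=y$, $\overline{y}\ne y$, $o(y)=t(\overline{y})$ for all $y\in EX$ (loops and multiple edges are allowed). The degree of a vertex $x$ is the number of $y\in EX$ with $o(y)=x$; $X$ is $d$-regular if every vertex has degree $d$. A path of length $k\ge 1$ from $x_0$ to $x$ is a sequence of edges $y_0,\dots,y_{k-1}$ with $o(y_0)=x_0$, $t(y_i)=o(y_{i+1})$ and $t(y_{k-1})=x$; a path of length $0$ is a single vertex. A path has backtracking if $y_{i+1}=\overline{y_i}$ for some $i$. A geodesic is a path without backtracking. Let $c_m(x)$ be the number of geodesics of length $m$ from $x_0$ to $x$ (so $c_0(x)=1$ if $x=x_0$ and $c_0(x)=0$ otherwise), and $b_m(x)=c_m(x)-(q-1)(c_{m-2}(x)+c_{m-4}(x)+\cdots)$, where the last term in the parenthesis is $c_1(x)$ if $m$ is odd and $c_0(x)$ if $m$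 is even ($b_0(x)=c_0(x)$, $b_1(x)=c_1(x)$). The Laplacian on functions $f$ on $VX$ is $\Delta f(x)=(q+1)f(x)-\sum_{e:\,o(e)=x} f(t(e))$; it is a bounded nonnegative self-adjoint operator on $L^2(VX)$. The heat kernel $K_X(t,x_0,x)$, $t\ge 0$, is the unique bounded solution of $\Delta K_X(t,x_0,x)+\frac{\partial}{\partial t}K_X(t,x_0,x)=0$ (with $\Delta$ acting in $x$), $K_X(0,x_0,x)=1$ if $x=x_0$ and $0$ otherwise. The spectral measure $\mu_x$ is the (finite signed) measure on the spectrum of $\Delta$ given by $\mu_x(B)=\langle E(B)\delta_{x_0},\delta_x\rangle$, with $E$ the spectral resolution of $\Delta$; it satisfies $K_X(t,x_0,x)=\int e^{-\lambda t}\,d\mu_x(\lambda)$ for all $t\ge0$. The logarithm is the principal branch. *)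

theory Defs
  imports
    "HOL-Analysis.Analysis"
    "Graph_Theory.Graph_Theory"
begin

section \<open>Graphs and geodesics\<close>

text \<open>
  A graph with oriented edges, origin and terminus maps and a fixed-point-free edge reversal is a
  \<^locale>\<open>bidirected_digraph\<close>; there \<open>arev\<close> is extended by the identity outside the edge set.
  Vertex and edge sets may be infinite.
\<close>

definition regular_graph :: "nat \<Rightarrow> ('v, 'e) pre_digraph \<Rightarrow> bool" where
  "regular_graph d G \<longleftrightarrow> (\<forall>v\<in>verts G. finite (out_arcs G v) \<and> out_degree G v = d)"

definition backtracking :: "('e \<Rightarrow> 'e) \<Rightarrow> 'e list \<Rightarrow> bool" where
  "backtracking arev p \<longleftrightarrow> (\<exists>i. Suc i < length p \<and> p ! Suc i = arev (p ! i))"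

definition geodesic ::
    "('v, 'e) pre_digraph \<Rightarrow> ('e \<Rightarrow> 'e) \<Rightarrow> 'v \<Rightarrow> 'e list \<Rightarrow> 'v \<Rightarrow> bool" where
  "geodesic G arev v p w \<longleftrightarrow> pre_digraph.awalk G v p w \<and> \<not> backtracking arev p"

definition geod_count ::
    "('v, 'e) pre_digraph \<Rightarrow> ('e \<Rightarrow> 'e) \<Rightarrow> 'v \<Rightarrow> nat \<Rightarrow> 'v \<Rightarrow> nat" where
  "geod_count G arev x0 m x = card {p. geodesic G arev x0 p x \<and> length p = m}"

definition geod_coeff ::
    "nat \<Rightarrow> ('v, 'e) pre_digraph \<Rightarrow> ('e \<Rightarrow> 'e) \<Rightarrow> 'v \<Rightarrow> nat \<Rightarrow> 'v \<Rightarrow> int" where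
  "geod_coeff q G arev x0 m x =
     int (geod_count G arev x0 m x)
     - (int q - 1) * (\<Sum>j = 1..m div 2. int (geod_count G arev x0 (m - 2 * j) x))"

text \<open>The index is shifted: the \<open>n\<close>-th term is the one of degree \<open>m = Suc n\<close>.\<close>

definition log_zeta_term ::
    "nat \<Rightarrow> ('v, 'e) pre_digraph \<Rightarrow> ('e \<Rightarrow> 'e) \<Rightarrow> 'v \<Rightarrow> complex \<Rightarrow> 'v \<Rightarrow> nat \<Rightarrow> complex" where
  "log_zeta_term q G arev x0 u x n =
     of_int (geod_coeff q G arev x0 (Suc n) x) / of_nat (Suc n) * u ^ Suc n"

definition log_zeta ::
    "nat \<Rightarrow> ('v, 'e) pre_digraph \<Rightarrow> ('e \<Rightarrow> 'e) \<Rightarrow> 'v \<Rightarrow> complex \<Rightarrow> 'v \<Rightarrow> complex" where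
  "log_zeta q G arev x0 u x = (\<Sum>n. log_zeta_term q G arev x0 u x n)"


section \<open>Square-summable functions and the Laplacian\<close>

text \<open>
  Functions on a set \<open>V\<close> are represented by total functions vanishing outside \<open>V\<close>. The scalar
  product is linear in the first argument.
\<close>

definition l2 :: "'v set \<Rightarrow> ('v \<Rightarrow> complex) set" where
  "l2 V = {f. (\<forall>v. v \<notin> V \<longrightarrow> f v = 0) \<and> (\<lambda>v. (cmod (f v))\<^sup>2) summable_on V}"

definition l2_inner :: "'v set \<Rightarrow> ('v \<Rightarrow> complex) \<Rightarrow> ('v \<Rightarrow> complex) \<Rightarrow> complex" where
  "l2_inner V f g = (\<Sum>\<^sub>\<infinity>v\<in>V. f v * cnj (g v))"

definition l2_norm :: "'v set \<Rightarrow> ('v \<Rightarrow> complex) \<Rightarrow> real" where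
  "l2_norm V f = sqrt (\<Sum>\<^sub>\<infinity>v\<in>V. (cmod (f v))\<^sup>2)"

definition l2_bounded_operator ::
    "'v set \<Rightarrow> (('v \<Rightarrow> complex) \<Rightarrow> ('v \<Rightarrow> complex)) \<Rightarrow> bool" where
  "l2_bounded_operator V T \<longleftrightarrow>
     (\<forall>f\<in>l2 V. T f \<in> l2 V) \<and>
     (\<forall>f\<in>l2 V. \<forall>g\<in>l2 V. T (\<lambda>v. f v + g v) = (\<lambda>v. T f v + T g v)) \<and>
     (\<forall>f\<in>l2 V. \<forall>c. T (\<lambda>v. c * f v) = (\<lambda>v. c * T f v)) \<and>
     (\<exists>C. \<forall>f\<in>l2 V. l2_norm V (T f) \<le> C * l2_norm V f)"

definition laplacian ::
    "nat \<Rightarrow> ('v, 'e) pre_digraph \<Rightarrow> ('v \<Rightarrow> complex) \<Rightarrow> ('v \<Rightarrow> complex)" where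
  "laplacian q G f = (\<lambda>v. (of_nat q + 1) * f v - (\<Sum>e\<in>out_arcs G v. f (head G e)))"

definition l2_spectrum ::
    "'v set \<Rightarrow> (('v \<Rightarrow> complex) \<Rightarrow> ('v \<Rightarrow> complex)) \<Rightarrow> complex set" where
  "l2_spectrum V T =
     {z. \<not> (\<exists>S. l2_bounded_operator V S \<and>
            (\<forall>f\<in>l2 V. S (\<lambda>v. T f v - z * f v) = f \<and>
                       (\<lambda>v. T (S f) v - z * S f v) = f))}"


section \<open>Integration against finite signed and complex measures\<close>

text \<open>
  A finite signed measure on the Borel sets of the line is a real-valued set function; it is
  integrated through its Jordan decomposition. In the positive variation, \<^const>\<open>ennreal\<close>
  truncates negative values, which does not affect the supremum since the empty set has measure 0.
\<close>

definition pos_variation :: "(real set \<Rightarrow> real) \<Rightarrow> real measure" where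
  "pos_variation \<nu> =
     measure_of UNIV (sets borel) (\<lambda>B. SUP A\<in>{A \<in> sets borel. A \<subseteq> B}. ennreal (\<nu> A))"

definition neg_variation :: "(real set \<Rightarrow> real) \<Rightarrow> real measure" where
  "neg_variation \<nu> = pos_variation (\<lambda>A. - \<nu> A)"

definition signed_integrable :: "(real set \<Rightarrow> real) \<Rightarrow> (real \<Rightarrow> complex) \<Rightarrow> bool" where
  "signed_integrable \<nu> f \<longleftrightarrow> integrable (pos_variation \<nu>) f \<and> integrable (neg_variation \<nu>) f"

definition signed_integral :: "(real set \<Rightarrow> real) \<Rightarrow> (real \<Rightarrow> complex) \<Rightarrow> complex" where
  "signed_integral \<nu> f = integral\<^sup>L (pos_variation \<nu>) f - integral\<^sup>L (neg_variation \<nu>) f"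

definition cmeasure_integrable :: "(real set \<Rightarrow> complex) \<Rightarrow> (real \<Rightarrow> complex) \<Rightarrow> bool" where
  "cmeasure_integrable \<mu> f \<longleftrightarrow>
     signed_integrable (\<lambda>B. Re (\<mu> B)) f \<and> signed_integrable (\<lambda>B. Im (\<mu> B)) f"

definition cmeasure_integral :: "(real set \<Rightarrow> complex) \<Rightarrow> (real \<Rightarrow> complex) \<Rightarrow> complex" where
  "cmeasure_integral \<mu> f =
     signed_integral (\<lambda>B. Re (\<mu> B)) f + \<i> * signed_integral (\<lambda>B. Im (\<mu> B)) f"


section \<open>Spectral resolutions\<close>

definition resolution_of_identity ::
    "'v set \<Rightarrow> (real set \<Rightarrow> ('v \<Rightarrow> complex) \<Rightarrow> ('v \<Rightarrow> complex)) \<Rightarrow> bool" where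
  "resolution_of_identity V E \<longleftrightarrow>
     (\<forall>B\<in>sets borel. l2_bounded_operator V (E B)) \<and>
     (\<forall>B\<in>sets borel. \<forall>f\<in>l2 V. E B (E B f) = E B f) \<and>
     (\<forall>B\<in>sets borel. \<forall>f\<in>l2 V. \<forall>g\<in>l2 V. l2_inner V (E B f) g = l2_inner V f (E B g)) \<and>
     (\<forall>f\<in>l2 V. E {} f = (\<lambda>_. 0) \<and> E UNIV f = f) \<and>
     (\<forall>A\<in>sets borel. \<forall>B\<in>sets borel. \<forall>f\<in>l2 V. E (A \<inter> B) f = E A (E B f)) \<and>
     (\<forall>A. range A \<subseteq> sets borel \<longrightarrow> disjoint_family A \<longrightarrow>
        (\<forall>f\<in>l2 V. \<forall>g\<in>l2 V.
           (\<lambda>i. l2_inner V (E (A i) f) g) sums l2_inner V (E (\<Union>i. A i) f) g))"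

text \<open>
  The spectral resolution of a bounded self-adjoint operator \<open>T\<close> is the resolution of the identity
  on the Borel subsets of its spectrum with \<open>T = \<integral> s dE(s)\<close> in the weak sense. It is regarded as
  defined on all Borel subsets of the line, concentrated on the (real) spectrum of \<open>T\<close>.
\<close>

definition spectral_resolution ::
    "'v set \<Rightarrow> (('v \<Rightarrow> complex) \<Rightarrow> ('v \<Rightarrow> complex)) \<Rightarrow>
     (real set \<Rightarrow> ('v \<Rightarrow> complex) \<Rightarrow> ('v \<Rightarrow> complex)) \<Rightarrow> bool" where
  "spectral_resolution V T E \<longleftrightarrow>
     resolution_of_identity V E \<and>
     (\<forall>f\<in>l2 V. E {s. complex_of_real s \<in> l2_spectrum V T} f = f) \<and>
     (\<forall>f\<in>l2 V. \<forall>g\<in>l2 V.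
        cmeasure_integrable (\<lambda>B. l2_inner V (E B f) g) complex_of_real \<and>
        l2_inner V (T f) g = cmeasure_integral (\<lambda>B. l2_inner V (E B f) g) complex_of_real)"

text \<open>For the Laplacian this set function is real-valued, i.e. a finite signed measure.\<close>

definition spectral_measure ::
    "'v set \<Rightarrow> (real set \<Rightarrow> ('v \<Rightarrow> complex) \<Rightarrow> ('v \<Rightarrow> complex)) \<Rightarrow> 'v \<Rightarrow> 'v \<Rightarrow>
     real set \<Rightarrow> complex" where
  "spectral_measure V E x0 x = (\<lambda>B. l2_inner V (E B (indicator {x0})) (indicator {x}))"

end

theory Submission
  imports Defs "HOL-Complex_Analysis.Cauchy_Integral_Theorem"
begin

text \<open>
  Let \<open>A f(v) = \<Sum> f(t(e))\<close>, summed over the edges leaving \<open>v\<close>, so that \<open>\<Delta> = (q + 1) - A\<close>.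
  Extending a geodesic by one edge either gives a longer geodesic or makes it backtrack, whence
  \<open>A c\<^sub>m = c\<^sub>m\<^sub>+\<^sub>1 + q c\<^sub>m\<^sub>-\<^sub>1\<close>, except that \<open>q\<close> is replaced by \<open>q + 1\<close> for \<open>m = 1\<close>, because the empty
  path can be extended in every direction. The correction terms in \<open>b\<^sub>m\<close> absorb this exception:
  once the sequence is started with \<open>2 c\<^sub>0\<close> in degree 0, it satisfies
  \<open>b\<^sub>m\<^sub>+\<^sub>2 = A b\<^sub>m\<^sub>+\<^sub>1 - q b\<^sub>m\<close> throughout (\<open>geod_vec_1\<close>, \<open>geod_vec_Suc_Suc\<close>). This is the recurrence of
  the Lucas polynomials \<open>V\<^sub>m(a, q) = \<alpha>\<^sup>m + \<beta>\<^sup>m\<close>, where \<open>\<alpha> + \<beta> = a\<close> and \<open>\<alpha> \<beta> = q\<close>; therefore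
  \<open>b\<^sub>m = V\<^sub>m(A, q) \<delta>\<close> for \<open>m \<ge> 1\<close>, with \<open>\<delta>\<close> the indicator of the base vertex. On the other hand,
  \<open>1 - a u + q u\<^sup>2 = (1 - \<alpha> u) (1 - \<beta> u)\<close> gives \<open>- log (1 - a u + q u\<^sup>2) = \<Sum> V\<^sub>m(a, q) u\<^sup>m / m\<close>
  (\<open>lucas_V_log_series\<close>). Integrating with \<open>a = q + 1 - \<lambda>\<close> against the spectral measure, term by
  term, gives the claim.

  What remains is the functional calculus for the polynomials \<open>V\<^sub>m\<close>. A resolution of the identity
  represents \<open>\<Delta>\<close> only weakly, \<open>\<langle>\<Delta>f, g\<rangle> = \<integral> s d\<langle>E(s)f, g\<rangle>\<close>, and powers of \<open>\<Delta>\<close> are reached through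
  \<open>\<langle>E(B)\<Delta>f, g\<rangle> = \<langle>\<Delta>f, E(B)g\<rangle> = \<integral>\<^sub>B s d\<langle>E(s)f, g\<rangle>\<close> (\<open>has_spectral_density_operator\<close>). To avoid
  working with Jordan decompositions, all complex measures in question are written as densities
  with respect to one finite positive measure \<open>M\<close>, which polarization and the Radon-Nikodym theorem
  provide (\<open>ex_density\<close>); a density has the obvious positive variation
  (\<open>pos_variation_density\<close>). Applying \<open>\<Delta>\<close> then multiplies the density by \<open>s\<close>.

  Finally, \<open>M\<close> has bounded support. If \<open>f\<close> lies in the range of \<open>E([R, \<infinity>))\<close>, then
  \<open>\<langle>\<Delta>f, f\<rangle> \<ge> R \<parallel>f\<parallel>\<^sup>2\<close>, whereas \<open>\<bar>\<langle>\<Delta>f, f\<rangle>\<bar> \<le> 2 (q + 1) \<parallel>f\<parallel>\<^sup>2\<close> by summing over edges; so \<open>f = 0\<close> for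
  \<open>R > 2 (q + 1)\<close>, and likewise at the other end (\<open>E_outside_numerical_bound\<close>). This makes the
  logarithmic series converge uniformly on the support for small \<open>u\<close>.
\<close>

section \<open>Set functions given by a density\<close>

text \<open>
  The supremum defining the positive variation of \<open>B\<close> is attained at the part of \<open>B\<close> on which the
  density is positive. Since \<^const>\<open>ennreal\<close> truncates, the density need not be replaced by its
  positive part.
\<close>

lemma pos_variation_density:
  fixes h :: "real \<Rightarrow> real"
  assumes sets [measurable_cong]: "sets M = sets borel"
    and h: "integrable M h"
    and \<nu>: "\<And>B. B \<in> sets borel \<Longrightarrow> \<nu> B = (\<integral>s. indicator B s *\<^sub>R h s \<partial>M)"
  shows "pos_variation \<nu> = density M (\<lambda>s. ennreal (h s))"
proof -
  note [measurable] = borel_measurable_integrable[OF h]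
  have int_pos: "integrable M (\<lambda>s. max 0 (h s))"
    using h by simp
  have eq: "(SUP A\<in>{A \<in> sets borel. A \<subseteq> B}. ennreal (\<nu> A)) =
      emeasure (density M (\<lambda>s. ennreal (h s))) B" if B: "B \<in> sets borel" for B
  proof -
    have [measurable]: "B \<in> sets M" using B sets by simp
    have intB: "integrable M (\<lambda>s. indicator B s *\<^sub>R max 0 (h s))"
      using int_pos by (intro integrable_mult_indicator) auto
    have "emeasure (density M (\<lambda>s. ennreal (h s))) B = (\<integral>\<^sup>+s. ennreal (h s) * indicator B s \<partial>M)"
      by (rule emeasure_density) auto
    also have "\<dots> = (\<integral>\<^sup>+s. ennreal (indicator B s *\<^sub>R max 0 (h s)) \<partial>M)"
      by (intro nn_integral_cong) (auto split: split_indicator simp: max_def ennreal_neg)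
    also have "\<dots> = ennreal (\<integral>s. indicator B s *\<^sub>R max 0 (h s) \<partial>M)"
      by (intro nn_integral_eq_integral intB) auto
    finally have em: "emeasure (density M (\<lambda>s. ennreal (h s))) B =
      ennreal (\<integral>s. indicator B s *\<^sub>R max 0 (h s) \<partial>M)" .
    show ?thesis
    proof (rule antisym)
      show "(SUP A\<in>{A \<in> sets borel. A \<subseteq> B}. ennreal (\<nu> A)) \<le>
          emeasure (density M (\<lambda>s. ennreal (h s))) B"
      proof (rule SUP_least)
        fix A assume "A \<in> {A \<in> sets borel. A \<subseteq> B}"
        then have A: "A \<in> sets borel" and sub: "A \<subseteq> B" by auto
        have [measurable]: "A \<in> sets M" using A sets by simp
        have "\<nu> A \<le> (\<integral>s. indicator B s *\<^sub>R max 0 (h s) \<partial>M)"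
          unfolding \<nu>[OF A] using sub
          by (intro integral_mono intB integrable_mult_indicator h)
            (auto split: split_indicator)
        then show "ennreal (\<nu> A) \<le> emeasure (density M (\<lambda>s. ennreal (h s))) B"
          unfolding em by (rule ennreal_leI)
      qed
      define A where "A = {s \<in> space M. s \<in> B \<and> h s > 0}"
      have "A \<in> sets M" unfolding A_def by measurable
      then have A: "A \<in> sets borel" using sets by simp
      have "space M = UNIV" using sets_eq_imp_space_eq[OF sets] by simp
      then have "\<nu> A = (\<integral>s. indicator B s *\<^sub>R max 0 (h s) \<partial>M)"
        unfolding \<nu>[OF A] by (intro Bochner_Integration.integral_cong refl)
          (auto simp: A_def split: split_indicator)
      then have "emeasure (density M (\<lambda>s. ennreal (h s))) B = ennreal (\<nu> A)"
        using em by simp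
      also have "\<dots> \<le> (SUP A\<in>{A \<in> sets borel. A \<subseteq> B}. ennreal (\<nu> A))"
        using A by (intro SUP_upper) (auto simp: A_def)
      finally show "emeasure (density M (\<lambda>s. ennreal (h s))) B \<le>
          (SUP A\<in>{A \<in> sets borel. A \<subseteq> B}. ennreal (\<nu> A))" .
    qed
  qed
  have "pos_variation \<nu> =
      measure_of UNIV (sets borel) (emeasure (density M (\<lambda>s. ennreal (h s))))"
    unfolding pos_variation_def
    by (intro measure_of_eq eq) (auto simp: sets.sigma_sets_eq[of borel, simplified])
  also have "\<dots> = density M (\<lambda>s. ennreal (h s))"
    using measure_of_of_measure[of "density M (\<lambda>s. ennreal (h s))"] sets
      sets_eq_imp_space_eq[OF sets] by simp
  finally show ?thesis .
qed

lemma
  fixes h :: "real \<Rightarrow> real" and \<phi> :: "real \<Rightarrow> complex"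
  assumes sets [measurable_cong]: "sets M = sets borel"
    and h: "integrable M h"
    and \<nu>: "\<And>B. B \<in> sets borel \<Longrightarrow> \<nu> B = (\<integral>s. indicator B s *\<^sub>R h s \<partial>M)"
    and \<phi> [measurable]: "\<phi> \<in> borel_measurable borel"
    and h\<phi>: "integrable M (\<lambda>s. h s *\<^sub>R \<phi> s)"
  shows signed_integrable_density: "signed_integrable \<nu> \<phi>"
    and signed_integral_density: "signed_integral \<nu> \<phi> = (\<integral>s. h s *\<^sub>R \<phi> s \<partial>M)"
proof -
  note [measurable] = borel_measurable_integrable[OF h]
  have [measurable]: "\<phi> \<in> borel_measurable M" by measurable
  have trunc: "density M (\<lambda>s. ennreal (k s)) = density M (\<lambda>s. ennreal (max 0 (k s)))" for k :: "real \<Rightarrow> real"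
    by (rule arg_cong[where f = "density M"]) (auto simp: fun_eq_iff max_def ennreal_neg)
  have pos: "pos_variation \<nu> = density M (\<lambda>s. ennreal (max 0 (h s)))"
    using pos_variation_density[OF sets h \<nu>] trunc by simp
  have neg: "neg_variation \<nu> = density M (\<lambda>s. ennreal (max 0 (- h s)))"
    unfolding neg_variation_def trunc[symmetric]
    by (rule pos_variation_density[OF sets]) (use h \<nu> in auto)
  have i1: "integrable M (\<lambda>s. max 0 (h s) *\<^sub>R \<phi> s)"
    by (rule Bochner_Integration.integrable_bound[OF h\<phi>]) (auto intro!: mult_right_mono)
  have i2: "integrable M (\<lambda>s. max 0 (- h s) *\<^sub>R \<phi> s)"
    by (rule Bochner_Integration.integrable_bound[OF h\<phi>]) (auto intro!: mult_right_mono)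
  show "signed_integrable \<nu> \<phi>"
    unfolding signed_integrable_def pos neg using i1 i2 by (auto simp: integrable_density)
  have "signed_integral \<nu> \<phi> =
      (\<integral>s. max 0 (h s) *\<^sub>R \<phi> s \<partial>M) - (\<integral>s. max 0 (- h s) *\<^sub>R \<phi> s \<partial>M)"
    unfolding signed_integral_def pos neg by (auto simp: integral_density)
  also have "\<dots> = (\<integral>s. max 0 (h s) *\<^sub>R \<phi> s - max 0 (- h s) *\<^sub>R \<phi> s \<partial>M)"
    using i1 i2 by simp
  also have "\<dots> = (\<integral>s. h s *\<^sub>R \<phi> s \<partial>M)"
    by (intro Bochner_Integration.integral_cong refl) (auto simp: max_def)
  finally show "signed_integral \<nu> \<phi> = (\<integral>s. h s *\<^sub>R \<phi> s \<partial>M)" .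
qed

lemma
  fixes h \<phi> :: "real \<Rightarrow> complex"
  assumes sets [measurable_cong]: "sets M = sets borel"
    and h: "integrable M h"
    and \<mu>: "\<And>B. B \<in> sets borel \<Longrightarrow> \<mu> B = (\<integral>s. indicator B s *\<^sub>R h s \<partial>M)"
    and \<phi> [measurable]: "\<phi> \<in> borel_measurable borel"
    and h\<phi>: "integrable M (\<lambda>s. h s * \<phi> s)"
  shows cmeasure_integrable_density: "cmeasure_integrable \<mu> \<phi>"
    and cmeasure_integral_density: "cmeasure_integral \<mu> \<phi> = (\<integral>s. h s * \<phi> s \<partial>M)"
proof -
  note [measurable] = borel_measurable_integrable[OF h]
  have [measurable]: "\<phi> \<in> borel_measurable M" by measurable
  have intB: "integrable M (\<lambda>s. indicator B s *\<^sub>R h s)" if "B \<in> sets borel" for B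
    using that sets by (intro integrable_mult_indicator h) auto
  have re: "Re (\<mu> B) = (\<integral>s. indicator B s *\<^sub>R Re (h s) \<partial>M)"
    and im: "Im (\<mu> B) = (\<integral>s. indicator B s *\<^sub>R Im (h s) \<partial>M)" if "B \<in> sets borel" for B
    using integral_Re[OF intB[OF that]] integral_Im[OF intB[OF that]] \<mu>[OF that] by simp_all
  have i1: "integrable M (\<lambda>s. Re (h s) *\<^sub>R \<phi> s)"
    by (rule Bochner_Integration.integrable_bound[OF h\<phi>])
      (auto intro!: mult_right_mono abs_Re_le_cmod simp: norm_mult)
  have i2: "integrable M (\<lambda>s. Im (h s) *\<^sub>R \<phi> s)"
    by (rule Bochner_Integration.integrable_bound[OF h\<phi>])
      (auto intro!: mult_right_mono abs_Im_le_cmod simp: norm_mult)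
  have hR: "integrable M (\<lambda>s. Re (h s))" "integrable M (\<lambda>s. Im (h s))"
    using h by auto
  show "cmeasure_integrable \<mu> \<phi>"
    unfolding cmeasure_integrable_def
    using signed_integrable_density[OF sets hR(1) re \<phi> i1]
      signed_integrable_density[OF sets hR(2) im \<phi> i2] by auto
  have "cmeasure_integral \<mu> \<phi> =
      (\<integral>s. Re (h s) *\<^sub>R \<phi> s \<partial>M) + \<i> * (\<integral>s. Im (h s) *\<^sub>R \<phi> s \<partial>M)"
    unfolding cmeasure_integral_def
    using signed_integral_density[OF sets hR(1) re \<phi> i1]
      signed_integral_density[OF sets hR(2) im \<phi> i2] by auto
  also have "\<dots> = (\<integral>s. Re (h s) *\<^sub>R \<phi> s + \<i> * (Im (h s) *\<^sub>R \<phi> s) \<partial>M)"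
    using i1 i2 by (simp del: mult_scaleR_right)
  also have "\<dots> = (\<integral>s. h s * \<phi> s \<partial>M)"
  proof (intro Bochner_Integration.integral_cong refl)
    fix s show "Re (h s) *\<^sub>R \<phi> s + \<i> * (Im (h s) *\<^sub>R \<phi> s) = h s * \<phi> s"
      by (subst (3) complex_eq[of "h s"]) (simp add: scaleR_conv_of_real algebra_simps)
  qed
  finally show "cmeasure_integral \<mu> \<phi> = (\<integral>s. h s * \<phi> s \<partial>M)" .
qed

section \<open>Complex combinations of finite measures have a density\<close>

lemma ex_finite_measure_of_set_function:
  fixes m :: "real set \<Rightarrow> real"
  assumes nonneg: "\<And>B. B \<in> sets borel \<Longrightarrow> 0 \<le> m B"
    and empty: "m {} = 0"
    and sums: "\<And>A. range A \<subseteq> sets borel \<Longrightarrow> disjoint_family A \<Longrightarrow>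
      (\<lambda>i. m (A i)) sums m (\<Union>i. A i)"
  obtains N where "sets N = sets borel" "finite_measure N"
    "\<And>B. B \<in> sets borel \<Longrightarrow> measure N B = m B"
proof
  define N where "N = measure_of UNIV (sets borel) (\<lambda>B. ennreal (m B))"
  have sets_N: "sets N = sets borel"
    unfolding N_def using sets.sigma_sets_eq[of "borel :: real measure"] by (simp add: sets_measure_of)
  have em: "emeasure N B = ennreal (m B)" if B: "B \<in> sets borel" for B
  proof (rule emeasure_measure_of[OF N_def])
    show "B \<in> sets N" using B sets_N by simp
    show "positive (sets N) (\<lambda>B. ennreal (m B))"
      by (simp add: positive_def empty)
    show "countably_additive (sets N) (\<lambda>B. ennreal (m B))"
      unfolding countably_additive_def sets_N
    proof (intro allI impI)
      fix A :: "nat \<Rightarrow> real set"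
      assume A: "range A \<subseteq> sets borel" "disjoint_family A"
      then have nn: "0 \<le> m (A i)" for i using nonneg by (auto simp: image_subset_iff)
      show "(\<Sum>i. ennreal (m (A i))) = ennreal (m (\<Union> (range A)))"
        using sums[OF A] nn by (subst suminf_ennreal2) (auto simp: sums_iff)
    qed
  qed auto
  show "sets N = sets borel" by (rule sets_N)
  have "space N = UNIV" using sets_eq_imp_space_eq[OF sets_N] by simp
  then show "finite_measure N"
    by (intro finite_measureI) (simp add: em)
  show "measure N B = m B" if "B \<in> sets borel" for B
    using em[OF that] nonneg[OF that] by (simp add: measure_def)
qed

text \<open>
  The measures are absolutely continuous with respect to their sum \<open>M\<close>, so the Radon-Nikodym theorem
  applies. The last clause turns a common bound on the supports of the measures into a
  bound on the support of \<open>M\<close>.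
\<close>

lemma complex_combination_has_density:
  fixes n :: "nat \<Rightarrow> real measure" and c :: "nat \<Rightarrow> complex"
  assumes sets: "\<And>i. i \<in> I \<Longrightarrow> sets (n i) = sets borel"
    and fin: "\<And>i. i \<in> I \<Longrightarrow> finite_measure (n i)"
    and I: "finite I"
  obtains M h where "sets M = sets borel" "finite_measure M" "integrable M h"
    "\<And>B. B \<in> sets borel \<Longrightarrow>
       (\<Sum>i\<in>I. c i * of_real (measure (n i) B)) = (\<integral>s. indicator B s *\<^sub>R h s \<partial>M)"
    "\<And>B. B \<in> sets borel \<Longrightarrow> (\<And>i. i \<in> I \<Longrightarrow> measure (n i) B = 0) \<Longrightarrow> B \<in> null_sets M"
proof -
  obtain M where M: "sets M = sets borel" "finite_measure M"
    "\<And>B. B \<in> sets borel \<Longrightarrow> measure M B = (\<Sum>i\<in>I. measure (n i) B)"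
  proof (rule ex_finite_measure_of_set_function[of "\<lambda>B. \<Sum>i\<in>I. measure (n i) B"])
    fix A :: "nat \<Rightarrow> real set" assume A: "range A \<subseteq> sets borel" "disjoint_family A"
    show "(\<lambda>j. \<Sum>i\<in>I. measure (n i) (A j)) sums (\<Sum>i\<in>I. measure (n i) (\<Union>j. A j))"
    proof (rule sums_sum)
      fix i assume i: "i \<in> I"
      interpret finite_measure "n i" by (rule fin[OF i])
      show "(\<lambda>j. measure (n i) (A j)) sums measure (n i) (\<Union>j. A j)"
        using A sets[OF i] by (intro finite_measure_UNION) auto
    qed
  qed (auto intro: sum_nonneg)
  interpret M: finite_measure M by (rule M)
  have "\<exists>D. D \<in> borel_measurable M \<and> (\<forall>s. 0 \<le> D s) \<and> n i = density M (\<lambda>s. ennreal (D s))"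
    if i: "i \<in> I" for i
  proof -
    interpret N: finite_measure "n i" by (rule fin[OF i])
    have ac: "absolutely_continuous M (n i)"
      unfolding absolutely_continuous_def
    proof
      fix B assume B: "B \<in> null_sets M"
      then have bB: "B \<in> sets borel" and "measure M B = 0" using M(1) by (auto simp: null_sets_def measure_def)
      then have "(\<Sum>i\<in>I. measure (n i) B) = 0" using M(3) by simp
      then have "measure (n i) B = 0"
        using i I by (subst (asm) sum_nonneg_eq_0_iff) auto
      then show "B \<in> null_sets (n i)"
        using bB sets[OF i] by (auto simp: null_sets_def N.emeasure_eq_measure)
    qed
    have se: "sets (n i) = sets M" using sets[OF i] M(1) by simp
    obtain D where D: "D \<in> borel_measurable M" "AE x in M. RN_deriv M (n i) x = ennreal (D x)"
        "AE x in n i. 0 < D x" "\<And>x. 0 \<le> D x"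
      by (rule M.real_RN_deriv[OF fin[OF i] ac se]) blast
    have "n i = density M (RN_deriv M (n i))"
      by (rule M.density_RN_deriv[OF ac se, symmetric])
    also have "\<dots> = density M (\<lambda>s. ennreal (D s))"
      using D by (intro density_cong) auto
    finally show ?thesis using D by auto
  qed
  then obtain D where D: "\<And>i. i \<in> I \<Longrightarrow> D i \<in> borel_measurable M"
      "\<And>i s. i \<in> I \<Longrightarrow> 0 \<le> D i s"
      "\<And>i. i \<in> I \<Longrightarrow> n i = density M (\<lambda>s. ennreal (D i s))"
    by metis
  have int_D: "integrable M (D i)" if i: "i \<in> I" for i
  proof -
    interpret N: finite_measure "n i" by (rule fin[OF i])
    have "integrable (density M (\<lambda>s. ennreal (D i s))) (\<lambda>_. 1 :: real)"
      using N.integrable_const D(3)[OF i] by metis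
    then show ?thesis using D(1,2)[OF i] by (simp add: integrable_density)
  qed
  have mD: "measure (n i) B = (\<integral>s. indicator B s *\<^sub>R D i s \<partial>M)"
    if i: "i \<in> I" and B: "B \<in> sets borel" for i B
  proof -
    have [measurable]: "D i \<in> borel_measurable M" "B \<in> sets M" using D(1) i B M(1) by auto
    have "measure (n i) B = (\<integral>s. indicator B s \<partial>n i)"
      using B sets[OF i] by simp
    also have "\<dots> = (\<integral>s. indicator B s \<partial>density M (\<lambda>s. ennreal (D i s)))"
      using D(3)[OF i] by simp
    also have "\<dots> = (\<integral>s. D i s *\<^sub>R indicator B s \<partial>M)"
      using D(2)[OF i] by (subst integral_density) auto
    finally show ?thesis by (simp add: mult.commute)
  qed
  show ?thesis
  proof (rule that[of M "\<lambda>s. \<Sum>i\<in>I. c i * of_real (D i s)"])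
    show "integrable M (\<lambda>s. \<Sum>i\<in>I. c i * of_real (D i s))"
      using int_D by (intro Bochner_Integration.integrable_sum integrable_mult_right integrable_of_real)
    show "(\<Sum>i\<in>I. c i * of_real (measure (n i) B)) =
        (\<integral>s. indicator B s *\<^sub>R (\<Sum>i\<in>I. c i * of_real (D i s)) \<partial>M)" if B: "B \<in> sets borel" for B
    proof -
      have int: "integrable M (\<lambda>s. indicator B s *\<^sub>R D i s)" if "i \<in> I" for i
        using that B M(1) by (intro integrable_mult_indicator int_D) auto
      have "(\<Sum>i\<in>I. c i * of_real (measure (n i) B)) =
          (\<Sum>i\<in>I. (\<integral>s. c i * of_real (indicator B s *\<^sub>R D i s) \<partial>M))"
        using mD[OF _ B] int by (intro sum.cong refl) (simp del: real_scaleR_def of_real_mult)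
      also have "\<dots> = (\<integral>s. (\<Sum>i\<in>I. c i * of_real (indicator B s *\<^sub>R D i s)) \<partial>M)"
        using int by (intro Bochner_Integration.integral_sum[symmetric]
            integrable_mult_right integrable_of_real)
      also have "\<dots> = (\<integral>s. indicator B s *\<^sub>R (\<Sum>i\<in>I. c i * of_real (D i s)) \<partial>M)"
        by (intro Bochner_Integration.integral_cong refl) (auto split: split_indicator)
      finally show ?thesis .
    qed
    show "B \<in> null_sets M" if "B \<in> sets borel" "\<And>i. i \<in> I \<Longrightarrow> measure (n i) B = 0" for B
      using that M(1) by (auto simp: null_sets_def M.emeasure_eq_measure M(3))
  qed (use M in auto)
qed

section \<open>Square-summable and finitely supported functions\<close>

text \<open>
  All vectors whose scalar products have to be expanded are finitely supported. For them the scalar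
  product is a finite sum, so that sesquilinearity needs no summability argument.
\<close>

definition finsupp :: "'v set \<Rightarrow> ('v \<Rightarrow> complex) set" where
  "finsupp V = {f. finite {v. f v \<noteq> 0} \<and> {v. f v \<noteq> 0} \<subseteq> V}"

lemma finsupp_l2: "f \<in> finsupp V \<Longrightarrow> f \<in> l2 V"
proof -
  assume f: "f \<in> finsupp V"
  have "(\<lambda>v. (cmod (f v))\<^sup>2) summable_on V"
    using f by (intro finite_nonzero_values_imp_summable_on)
      (auto simp: finsupp_def elim: rev_finite_subset)
  then show "f \<in> l2 V" using f by (auto simp: l2_def finsupp_def)
qed

lemma finsupp_lincomb:
  "f \<in> finsupp V \<Longrightarrow> g \<in> finsupp V \<Longrightarrow> (\<lambda>v. a * f v + b * g v) \<in> finsupp V"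
proof -
  assume f: "f \<in> finsupp V" and g: "g \<in> finsupp V"
  have "{v. a * f v + b * g v \<noteq> 0} \<subseteq> {v. f v \<noteq> 0} \<union> {v. g v \<noteq> 0}" by auto
  moreover have "finite ({v. f v \<noteq> 0} \<union> {v. g v \<noteq> 0})" "{v. f v \<noteq> 0} \<union> {v. g v \<noteq> 0} \<subseteq> V"
    using f g unfolding finsupp_def by auto
  ultimately show ?thesis
    unfolding finsupp_def mem_Collect_eq by (meson finite_subset subset_trans)
qed

lemma l2_inner_finsupp:
  assumes "g \<in> finsupp V" "finite S" "{v. g v \<noteq> 0} \<subseteq> S"
  shows "l2_inner V f g = (\<Sum>v\<in>S. f v * cnj (g v))"
proof -
  have "l2_inner V f g = (\<Sum>\<^sub>\<infinity>v\<in>S. f v * cnj (g v))"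
    unfolding l2_inner_def using assms by (intro infsum_cong_neutral) (auto simp: finsupp_def)
  then show ?thesis using assms(2) by simp
qed

lemma l2_inner_lincomb_left:
  assumes "g \<in> finsupp V"
  shows "l2_inner V (\<lambda>v. a * f1 v + b * f2 v) g = a * l2_inner V f1 g + b * l2_inner V f2 g"
proof -
  have S: "finite {v. g v \<noteq> 0}" using assms by (simp add: finsupp_def)
  show ?thesis unfolding l2_inner_finsupp[OF assms S order_refl]
    by (simp add: sum_distrib_left sum.distrib algebra_simps)
qed

lemma l2_inner_lincomb_right:
  assumes "g1 \<in> finsupp V" "g2 \<in> finsupp V"
  shows "l2_inner V f (\<lambda>v. a * g1 v + b * g2 v) = cnj a * l2_inner V f g1 + cnj b * l2_inner V f g2"
proof -
  let ?S = "{v. g1 v \<noteq> 0} \<union> {v. g2 v \<noteq> 0}"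
  have S: "finite ?S" using assms by (simp add: finsupp_def)
  have eqs: "l2_inner V f g = (\<Sum>v\<in>?S. f v * cnj (g v))" if "g \<in> finsupp V" "{v. g v \<noteq> 0} \<subseteq> ?S" for g
    using l2_inner_finsupp[OF that(1) S that(2)] .
  show ?thesis
    by (subst eqs, rule finsupp_lincomb[OF assms], force, subst eqs, rule assms, force,
        subst eqs, rule assms, force)
      (simp add: sum_distrib_left sum.distrib algebra_simps)
qed

lemma l2_inner_self:
  assumes "f \<in> l2 V"
  shows "l2_inner V f f = of_real (\<Sum>\<^sub>\<infinity>v\<in>V. (cmod (f v))\<^sup>2)"
  unfolding l2_inner_def complex_norm_square[symmetric]
  using assms by (intro infsumI has_sum_of_real has_sum_infsum) (auto simp: l2_def)

lemma l2_inner_self_nonneg: "f \<in> l2 V \<Longrightarrow> 0 \<le> Re (l2_inner V f f)"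
  by (simp add: l2_inner_self infsum_nonneg)

section \<open>Spectral measures of a resolution of the identity\<close>

locale l2_resolution =
  fixes V :: "'v set" and E :: "real set \<Rightarrow> ('v \<Rightarrow> complex) \<Rightarrow> ('v \<Rightarrow> complex)"
  assumes resolution: "resolution_of_identity V E"
begin

lemma
  assumes "B \<in> sets borel"
  shows E_l2: "f \<in> l2 V \<Longrightarrow> E B f \<in> l2 V"
    and E_add: "f \<in> l2 V \<Longrightarrow> g \<in> l2 V \<Longrightarrow> E B (\<lambda>v. f v + g v) = (\<lambda>v. E B f v + E B g v)"
    and E_scale: "f \<in> l2 V \<Longrightarrow> E B (\<lambda>v. a * f v) = (\<lambda>v. a * E B f v)"
proof -
  have op: "l2_bounded_operator V (E B)"
    using resolution assms unfolding resolution_of_identity_def by (elim conjE bspec)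
  show "E B f \<in> l2 V" if "f \<in> l2 V"
    using op that unfolding l2_bounded_operator_def by (elim conjE bspec)
  show "E B (\<lambda>v. f v + g v) = (\<lambda>v. E B f v + E B g v)" if "f \<in> l2 V" "g \<in> l2 V"
    using op that unfolding l2_bounded_operator_def by simp
  show "E B (\<lambda>v. a * f v) = (\<lambda>v. a * E B f v)" if "f \<in> l2 V"
    using op that unfolding l2_bounded_operator_def by simp
qed

lemma E_selfadjoint:
  "B \<in> sets borel \<Longrightarrow> f \<in> l2 V \<Longrightarrow> g \<in> l2 V \<Longrightarrow> l2_inner V (E B f) g = l2_inner V f (E B g)"
  using resolution unfolding resolution_of_identity_def by blast

lemma E_UNIV: "f \<in> l2 V \<Longrightarrow> E UNIV f = f"
  using resolution unfolding resolution_of_identity_def by blast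

lemma E_empty: "f \<in> l2 V \<Longrightarrow> E {} f = (\<lambda>_. 0)"
  using resolution unfolding resolution_of_identity_def by blast

lemma E_Int:
  assumes "A \<in> sets borel" "B \<in> sets borel" "f \<in> l2 V"
  shows "E A (E B f) = E (A \<inter> B) f"
proof -
  have "E (A \<inter> B) f = E A (E B f)"
    using resolution assms unfolding resolution_of_identity_def by blast
  then show ?thesis by simp
qed

lemma E_sums:
  "range A \<subseteq> sets borel \<Longrightarrow> disjoint_family A \<Longrightarrow> f \<in> l2 V \<Longrightarrow> g \<in> l2 V \<Longrightarrow>
    (\<lambda>i. l2_inner V (E (A i) f) g) sums l2_inner V (E (\<Union>i. A i) f) g"
  using resolution unfolding resolution_of_identity_def by blast

lemma E_lincomb:
  assumes B: "B \<in> sets borel" and f: "f \<in> finsupp V" and g: "g \<in> finsupp V"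
  shows "E B (\<lambda>v. a * f v + b * g v) = (\<lambda>v. a * E B f v + b * E B g v)"
proof -
  have "(\<lambda>v. c * k v) \<in> l2 V" if "k \<in> finsupp V" for c k
    using finsupp_l2[OF finsupp_lincomb[OF that that, of c 0]] by simp
  then show ?thesis
    using f g by (simp add: E_add[OF B] E_scale[OF B] finsupp_l2)
qed

lemma E_diag_inner:
  assumes B: "B \<in> sets borel" and f: "f \<in> l2 V"
  shows "l2_inner V (E B f) f = l2_inner V (E B f) (E B f)"
  using E_selfadjoint[OF B E_l2[OF B f] f] E_Int[OF B B f] by simp

lemma E_diag_nonneg:
  assumes B: "B \<in> sets borel" and f: "f \<in> l2 V"
  shows "0 \<le> Re (l2_inner V (E B f) f)" "Im (l2_inner V (E B f) f) = 0"
  using l2_inner_self_nonneg[OF E_l2[OF B f]] l2_inner_self[OF E_l2[OF B f]]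
  by (simp_all add: E_diag_inner[OF B f])

lemma ex_diag_measure:
  assumes f: "f \<in> l2 V"
  obtains N where "sets N = sets borel" "finite_measure N"
    "\<And>B. B \<in> sets borel \<Longrightarrow> l2_inner V (E B f) f = of_real (measure N B)"
proof (rule ex_finite_measure_of_set_function[of "\<lambda>B. Re (l2_inner V (E B f) f)"])
  show "0 \<le> Re (l2_inner V (E B f) f)" if "B \<in> sets borel" for B
    by (rule E_diag_nonneg[OF that f])
  show "Re (l2_inner V (E {} f) f) = 0"
    using E_empty[OF f] by (simp add: l2_inner_def)
  show "(\<lambda>i. Re (l2_inner V (E (A i) f) f)) sums Re (l2_inner V (E (\<Union> (range A)) f) f)"
    if "range A \<subseteq> sets borel" "disjoint_family A" for A :: "nat \<Rightarrow> _"
    using E_sums[OF that f f] by (rule sums_Re)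
  fix N :: "real measure"
  assume N: "sets N = sets borel" "finite_measure N"
    "\<And>B. B \<in> sets borel \<Longrightarrow> measure N B = Re (l2_inner V (E B f) f)"
  show thesis
    using N E_diag_nonneg(2)[OF _ f] by (intro that[of N]) (auto simp: complex_eq_iff)
qed

lemma polarization:
  assumes B: "B \<in> sets borel" and f: "f \<in> finsupp V" and g: "g \<in> finsupp V"
  shows "(\<Sum>k<4. \<i> ^ k / 4 * l2_inner V (E B (\<lambda>v. f v + \<i> ^ k * g v)) (\<lambda>v. f v + \<i> ^ k * g v)) =
    l2_inner V (E B f) g"
proof -
  have expand: "l2_inner V (E B (\<lambda>v. f v + a * g v)) (\<lambda>v. f v + a * g v) =
     l2_inner V (E B f) f + cnj a * l2_inner V (E B f) g +
     a * (l2_inner V (E B g) f + cnj a * l2_inner V (E B g) g)" (is "?L a = ?R a") for a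
    using E_lincomb[OF B f g, of 1 a] l2_inner_lincomb_right[OF f g, of _ 1 a]
      l2_inner_lincomb_left[OF finsupp_lincomb[OF f g, of 1 a], of 1 _ a]
    by (simp add: algebra_simps)
  have "(\<Sum>k<4. \<i> ^ k / 4 * ?L (\<i> ^ k)) = (\<Sum>k<4. \<i> ^ k / 4 * ?R (\<i> ^ k))"
    by (simp only: expand)
  also have "\<dots> = l2_inner V (E B f) g"
    by (simp add: eval_nat_numeral algebra_simps)
  finally show ?thesis .
qed

text \<open>
  By polarization the complex measure \<open>B \<mapsto> \<langle>E(B)f, g\<rangle>\<close> is a combination of the four positive measures
  \<open>B \<mapsto> \<langle>E(B)w, w\<rangle>\<close> with \<open>w = f + \<i>\<^sup>k g\<close>, each of which vanishes on \<open>B\<close> whenever \<open>E(B) = 0\<close>.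
\<close>

lemma ex_density:
  assumes f: "f \<in> finsupp V" and g: "g \<in> finsupp V"
  obtains M h where "sets M = sets borel" "finite_measure M" "integrable M h"
    "\<And>B. B \<in> sets borel \<Longrightarrow> l2_inner V (E B f) g = (\<integral>s. indicator B s *\<^sub>R h s \<partial>M)"
    "\<And>B. B \<in> sets borel \<Longrightarrow> (\<And>k. k \<in> l2 V \<Longrightarrow> l2_inner V (E B k) k = 0) \<Longrightarrow> B \<in> null_sets M"
proof -
  let ?w = "\<lambda>k v. f v + \<i> ^ k * g v"
  have w: "?w k \<in> l2 V" for k
    using finsupp_l2[OF finsupp_lincomb[OF f g, of 1 "\<i> ^ k"]] by simp
  have "\<exists>N. sets N = sets borel \<and> finite_measure N \<and>
      (\<forall>B\<in>sets borel. l2_inner V (E B (?w k)) (?w k) = of_real (measure N B))" for k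
    by (rule ex_diag_measure[OF w]) blast
  then have "\<exists>n. \<forall>k. sets (n k) = sets borel \<and> finite_measure (n k) \<and>
      (\<forall>B\<in>sets borel. l2_inner V (E B (?w k)) (?w k) = of_real (measure (n k) B))"
    by (intro choice allI)
  then obtain n where n: "\<And>k. sets (n k) = sets borel" "\<And>k. finite_measure (n k)"
      "\<And>k B. B \<in> sets borel \<Longrightarrow> l2_inner V (E B (?w k)) (?w k) = of_real (measure (n k) B)"
    by blast
  show ?thesis
  proof (rule complex_combination_has_density[of "{..<4}" n "\<lambda>k. \<i> ^ k / 4"])
    fix M h
    assume M: "sets M = sets borel" "finite_measure M" "integrable M h"
      and eq: "\<And>B. B \<in> sets borel \<Longrightarrow>
       (\<Sum>k<4. \<i> ^ k / 4 * of_real (measure (n k) B)) = (\<integral>s. indicator B s *\<^sub>R h s \<partial>M)"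
      and null: "\<And>B. B \<in> sets borel \<Longrightarrow> (\<And>i. i \<in> {..<4} \<Longrightarrow> measure (n i) B = 0) \<Longrightarrow> B \<in> null_sets M"
    show thesis
    proof (rule that[OF M])
      fix B :: "real set" assume B: "B \<in> sets borel"
      show "l2_inner V (E B f) g = (\<integral>s. indicator B s *\<^sub>R h s \<partial>M)"
        unfolding eq[OF B, symmetric] n(3)[OF B, symmetric] by (rule polarization[OF B f g, symmetric])
      assume zero: "\<And>k. k \<in> l2 V \<Longrightarrow> l2_inner V (E B k) k = 0"
      have "measure (n i) B = 0" for i
        using n(3)[OF B, of i] zero[OF w[of i]] by simp
      then show "B \<in> null_sets M" by (intro null B)
    qed
  qed (simp_all add: n(1,2))
qed

text \<open>
  A vector \<open>f = E(D)k\<close> has its spectral measure on \<open>D\<close>, hence \<open>\<bar>\<langle>Tf, f\<rangle>\<bar> \<ge> R \<parallel>f\<parallel>\<^sup>2\<close>, which contradicts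
  the bound \<open>C \<parallel>f\<parallel>\<^sup>2\<close> unless \<open>f = 0\<close>. The sign \<open>\<sigma>\<close> treats both ends of the line at once. The argument
  replaces the usual one by Neumann series for the resolvent, which would need the completeness of
  the space.
\<close>

lemma E_outside_numerical_bound:
  assumes T: "\<And>f. f \<in> l2 V \<Longrightarrow> cmeasure_integrable (\<lambda>B. l2_inner V (E B f) f) of_real"
      "\<And>f. f \<in> l2 V \<Longrightarrow> l2_inner V (T f) f = cmeasure_integral (\<lambda>B. l2_inner V (E B f) f) of_real"
    and bound: "\<And>f. f \<in> l2 V \<Longrightarrow> cmod (l2_inner V (T f) f) \<le> C * Re (l2_inner V f f)"
    and D: "D \<in> sets borel" "\<And>s. s \<in> D \<Longrightarrow> R \<le> \<sigma> * s" and \<sigma>: "\<bar>\<sigma>\<bar> = 1" and R: "C < R"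
    and k: "k \<in> l2 V"
  shows "l2_inner V (E D k) k = 0"
proof -
  obtain N where N: "sets N = sets borel" "finite_measure N"
    "\<And>B. B \<in> sets borel \<Longrightarrow> l2_inner V (E B k) k = of_real (measure N B)"
    using ex_diag_measure[OF k] by blast
  interpret finite_measure N by (rule N(2))
  define f where "f = E D k"
  have f: "f \<in> l2 V" unfolding f_def by (rule E_l2[OF D(1) k])
  have DN [measurable]: "D \<in> sets N" using D(1) N(1) by simp
  have [measurable]: "complex_of_real \<in> borel_measurable N"
    unfolding measurable_cong_sets[OF N(1) refl] by simp
  have \<nu>: "l2_inner V (E B f) f = of_real (\<integral>s. indicator B s *\<^sub>R indicator D s \<partial>N)"
    if B: "B \<in> sets borel" for B
  proof -
    have "l2_inner V (E B f) f = l2_inner V (E D (E B f)) k"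
      unfolding f_def by (intro E_selfadjoint[symmetric] E_l2 D(1) B k)
    also have "\<dots> = l2_inner V (E (B \<inter> D) k) k"
      unfolding f_def using D(1) B k by (simp add: E_Int E_l2 Int_ac)
    also have "\<dots> = of_real (measure N (B \<inter> D))" using B D(1) by (intro N) auto
    also have "measure N (B \<inter> D) = (\<integral>s. indicator (B \<inter> D) s \<partial>N)"
      using B D(1) N(1) by simp
    finally show ?thesis by (simp add: indicator_inter_arith)
  qed
  have \<nu>': "l2_inner V (E B f) f = (\<integral>s. indicator B s *\<^sub>R complex_of_real (indicator D s) \<partial>N)"
    if "B \<in> sets borel" for B
    unfolding \<nu>[OF that] by (simp add: scaleR_conv_of_real flip: integral_complex_of_real)
  have int_D: "integrable N (indicator D :: real \<Rightarrow> real)"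
    using DN by (intro integrable_real_indicator) (auto simp: less_top[symmetric])
  \<comment> \<open>Integrability of \<open>s\<close> on \<open>D\<close>, which may be unbounded, can only come from the hypothesis.\<close>
  have "integrable (pos_variation (\<lambda>B. Re (l2_inner V (E B f) f))) complex_of_real"
    using T(1)[OF f] by (auto simp: cmeasure_integrable_def signed_integrable_def)
  also have "pos_variation (\<lambda>B. Re (l2_inner V (E B f) f)) = density N (\<lambda>s. ennreal (indicator D s))"
    by (rule pos_variation_density[OF N(1) int_D]) (simp add: \<nu>)
  finally have int_s: "integrable N (\<lambda>s. complex_of_real (indicator D s) * of_real s)"
    by (subst (asm) integrable_density) (auto simp: scaleR_conv_of_real)
  then have int_s': "integrable N (\<lambda>s. indicator D s * s)"
    using integrable_Re[OF int_s] by simp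
  have "l2_inner V (T f) f = (\<integral>s. complex_of_real (indicator D s) * of_real s \<partial>N)"
    unfolding T(2)[OF f]
    by (rule cmeasure_integral_density[OF N(1) integrable_of_real[OF int_D] \<nu>' _ int_s]) auto
  also have "\<dots> = of_real (\<integral>s. indicator D s * s \<partial>N)"
    by (subst integral_complex_of_real[symmetric]) simp
  finally have Tf: "l2_inner V (T f) f = of_real (\<integral>s. indicator D s * s \<partial>N)" .
  have ff: "l2_inner V f f = of_real (measure N D)"
    using \<nu>[of UNIV] E_UNIV[OF f] by simp
  have "R * measure N D = (\<integral>s. R * indicator D s \<partial>N)" by simp
  also have "\<dots> \<le> (\<integral>s. \<sigma> * (indicator D s * s) \<partial>N)"
    using D(2) int_D int_s' by (intro integral_mono) (auto split: split_indicator)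
  also have "\<dots> = \<sigma> * (\<integral>s. indicator D s * s \<partial>N)" by simp
  also have "\<dots> \<le> \<bar>\<integral>s. indicator D s * s \<partial>N\<bar>"
    using abs_ge_self[of "\<sigma> * (\<integral>s. indicator D s * s \<partial>N)"] \<sigma> by (simp add: abs_mult)
  also have "\<dots> \<le> C * measure N D"
    using bound[OF f] by (simp add: Tf ff)
  finally have "(R - C) * measure N D \<le> 0" by (simp add: algebra_simps)
  then have "measure N D = 0"
    using R measure_nonneg[of N D] by (simp add: mult_le_0_iff)
  then show ?thesis using N(3)[OF D(1)] by simp
qed

definition has_spectral_density ::
    "real measure \<Rightarrow> ('v \<Rightarrow> complex) \<Rightarrow> ('v \<Rightarrow> complex) \<Rightarrow> (real \<Rightarrow> complex) \<Rightarrow> bool" where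
  "has_spectral_density M g f k \<longleftrightarrow> integrable M k \<and>
    (\<forall>B\<in>sets borel. l2_inner V (E B f) g = (\<integral>s. indicator B s *\<^sub>R k s \<partial>M))"

lemma has_spectral_density_lincomb:
  assumes M: "sets M = sets borel" and f: "f1 \<in> finsupp V" "f2 \<in> finsupp V" and g: "g \<in> finsupp V"
    and k: "has_spectral_density M g f1 k1" "has_spectral_density M g f2 k2"
  shows "has_spectral_density M g (\<lambda>v. a * f1 v + b * f2 v) (\<lambda>s. a * k1 s + b * k2 s)"
  unfolding has_spectral_density_def
proof (intro conjI ballI)
  have int: "integrable M k1" "integrable M k2" using k by (auto simp: has_spectral_density_def)
  then show "integrable M (\<lambda>s. a * k1 s + b * k2 s)" by simp
  fix B :: "real set" assume B: "B \<in> sets borel"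
  have intB: "integrable M (\<lambda>s. indicator B s *\<^sub>R k1 s)" "integrable M (\<lambda>s. indicator B s *\<^sub>R k2 s)"
    using B M int by (auto intro!: integrable_mult_indicator)
  have "l2_inner V (E B (\<lambda>v. a * f1 v + b * f2 v)) g =
      a * (\<integral>s. indicator B s *\<^sub>R k1 s \<partial>M) + b * (\<integral>s. indicator B s *\<^sub>R k2 s \<partial>M)"
    using k B by (simp add: E_lincomb[OF B f] l2_inner_lincomb_left[OF g] has_spectral_density_def)
  also have "\<dots> = (\<integral>s. a * (indicator B s *\<^sub>R k1 s) + b * (indicator B s *\<^sub>R k2 s) \<partial>M)"
    using intB by (simp del: mult_scaleR_right)
  also have "\<dots> = (\<integral>s. indicator B s *\<^sub>R (a * k1 s + b * k2 s) \<partial>M)"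
    by (intro Bochner_Integration.integral_cong refl) (simp add: scaleR_add_right)
  finally show "l2_inner V (E B (\<lambda>v. a * f1 v + b * f2 v)) g =
      (\<integral>s. indicator B s *\<^sub>R (a * k1 s + b * k2 s) \<partial>M)" .
qed

text \<open>
  Moving \<open>E(B)\<close> to the second argument reduces the claim to the weak representation of \<open>T\<close>, because
  \<open>\<langle>E(A)f, E(B)g\<rangle> = \<langle>E(A \<inter> B)f, g\<rangle>\<close> has the density of \<open>f\<close> restricted to \<open>B\<close>.
\<close>

lemma has_spectral_density_operator:
  assumes T: "\<And>f g. f \<in> l2 V \<Longrightarrow> g \<in> l2 V \<Longrightarrow>
      l2_inner V (T f) g = cmeasure_integral (\<lambda>B. l2_inner V (E B f) g) of_real"
    and f: "f \<in> l2 V" "T f \<in> l2 V" and g: "g \<in> l2 V" and M: "sets M = sets borel"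
    and k: "has_spectral_density M g f k" "integrable M (\<lambda>s. of_real s * k s)"
  shows "has_spectral_density M g (T f) (\<lambda>s. of_real s * k s)"
  unfolding has_spectral_density_def
proof (intro conjI ballI k(2))
  fix B :: "real set" assume B: "B \<in> sets borel"
  have int: "integrable M k"
    and f_eq: "\<And>B. B \<in> sets borel \<Longrightarrow> l2_inner V (E B f) g = (\<integral>s. indicator B s *\<^sub>R k s \<partial>M)"
    using k(1) by (simp_all add: has_spectral_density_def)
  have BM: "B \<in> sets M" using B M by simp
  have \<nu>: "l2_inner V (E A f) (E B g) = (\<integral>s. indicator A s *\<^sub>R (indicator B s *\<^sub>R k s) \<partial>M)"
    if A: "A \<in> sets borel" for A
  proof -
    have "l2_inner V (E A f) (E B g) = l2_inner V (E B (E A f)) g"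
      by (intro E_selfadjoint[symmetric] E_l2 A B f g)
    also have "\<dots> = l2_inner V (E (A \<inter> B) f) g"
      using A B f by (simp add: E_Int Int_ac)
    finally show ?thesis
      using f_eq[of "A \<inter> B"] A B by (simp add: indicator_inter_arith)
  qed
  have ints: "integrable M (\<lambda>s. (indicator B s *\<^sub>R k s) * of_real s)"
    using integrable_mult_indicator[OF BM k(2)] by (simp add: mult.commute)
  have "l2_inner V (E B (T f)) g = l2_inner V (T f) (E B g)"
    by (rule E_selfadjoint[OF B f(2) g])
  also have "\<dots> = cmeasure_integral (\<lambda>A. l2_inner V (E A f) (E B g)) of_real"
    by (rule T[OF f(1) E_l2[OF B g]])
  also have "\<dots> = (\<integral>s. (indicator B s *\<^sub>R k s) * of_real s \<partial>M)"
    by (rule cmeasure_integral_density[OF M integrable_mult_indicator[OF BM int] \<nu> _ ints]) auto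
  finally show "l2_inner V (E B (T f)) g = (\<integral>s. indicator B s *\<^sub>R (of_real s * k s) \<partial>M)"
    by (simp add: mult.commute)
qed

end

section \<open>Lucas polynomials and the logarithmic series\<close>

fun lucas_V :: "complex \<Rightarrow> complex \<Rightarrow> nat \<Rightarrow> complex" where
  "lucas_V P Q 0 = 2"
| "lucas_V P Q (Suc 0) = P"
| "lucas_V P Q (Suc (Suc n)) = P * lucas_V P Q (Suc n) - Q * lucas_V P Q n"

lemma lucas_V_roots:
  assumes "\<alpha> + \<beta> = P" "\<alpha> * \<beta> = Q"
  shows "lucas_V P Q n = \<alpha> ^ n + \<beta> ^ n"
  by (induction n rule: induct_nat_012) (simp_all add: assms[symmetric] algebra_simps)

lemma quadratic_root_bound:
  fixes \<alpha> :: complex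
  assumes "\<alpha> + \<beta> = P" "\<alpha> * \<beta> = Q"
  shows "cmod \<alpha> \<le> 1 + cmod P + cmod Q"
proof (cases "cmod \<alpha> \<le> 1")
  case True
  then show ?thesis by (smt (verit) norm_ge_zero)
next
  case False
  have "\<alpha> * \<alpha> = P * \<alpha> - Q" by (simp add: assms[symmetric] algebra_simps)
  then have "cmod \<alpha> * cmod \<alpha> \<le> cmod P * cmod \<alpha> + cmod Q"
    by (metis norm_mult norm_triangle_ineq4)
  also have "\<dots> \<le> cmod P * cmod \<alpha> + cmod Q * cmod \<alpha>"
    using False mult_left_mono[of 1 "cmod \<alpha>" "cmod Q"] by simp
  finally have "cmod \<alpha> * cmod \<alpha> \<le> (cmod P + cmod Q) * cmod \<alpha>" by (simp add: algebra_simps)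
  then have "cmod \<alpha> \<le> cmod P + cmod Q"
    by (rule mult_right_le_imp_le) (use False in linarith)
  then show ?thesis by simp
qed

text \<open>
  Both factors of \<open>1 - P u + Q u\<^sup>2 = (1 - \<alpha> u) (1 - \<beta> u)\<close> have positive real part, so the principal
  logarithm of the product is the sum of the two logarithms.
\<close>

lemma lucas_V_log_series:
  assumes L: "1 + cmod P + cmod Q \<le> L" and u: "L * cmod u < 1"
  shows "(\<lambda>n. lucas_V P Q (Suc n) / of_nat (Suc n) * u ^ Suc n) sums - Ln (1 - P * u + Q * u\<^sup>2)"
    and "cmod (lucas_V P Q n * u ^ n) \<le> 2 * (L * cmod u) ^ n"
proof -
  define \<alpha> where "\<alpha> = (P + csqrt (P\<^sup>2 - 4 * Q)) / 2"
  define \<beta> where "\<beta> = (P - csqrt (P\<^sup>2 - 4 * Q)) / 2"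
  have sum: "\<alpha> + \<beta> = P" by (simp add: \<alpha>_def \<beta>_def field_simps)
  have "4 * (\<alpha> * \<beta>) = P\<^sup>2 - (csqrt (P\<^sup>2 - 4 * Q))\<^sup>2"
    by (simp add: \<alpha>_def \<beta>_def field_simps power2_eq_square)
  then have prod: "\<alpha> * \<beta> = Q" by simp
  have "cmod \<alpha> \<le> L" using quadratic_root_bound[OF sum prod] L by simp
  then have \<alpha>u: "cmod (\<alpha> * u) \<le> L * cmod u" by (simp add: norm_mult mult_right_mono)
  have "cmod \<beta> \<le> L"
    using quadratic_root_bound[of \<beta> \<alpha> P Q] sum prod L by (simp add: ac_simps)
  then have \<beta>u: "cmod (\<beta> * u) \<le> L * cmod u" by (simp add: norm_mult mult_right_mono)
  have V: "lucas_V P Q n * u ^ n = (\<alpha> * u) ^ n + (\<beta> * u) ^ n" for n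
    by (simp add: lucas_V_roots[OF sum prod] power_mult_distrib algebra_simps)
  show "cmod (lucas_V P Q n * u ^ n) \<le> 2 * (L * cmod u) ^ n"
  proof -
    have "cmod ((\<alpha> * u) ^ n + (\<beta> * u) ^ n) \<le> cmod (\<alpha> * u) ^ n + cmod (\<beta> * u) ^ n"
      by (metis norm_triangle_ineq norm_power)
    also have "\<dots> \<le> (L * cmod u) ^ n + (L * cmod u) ^ n"
      by (intro add_mono power_mono \<alpha>u \<beta>u) auto
    finally show ?thesis by (simp add: V)
  qed
  have ser: "(\<lambda>n. z ^ Suc n / of_nat (Suc n)) sums - Ln (1 - z)" if "cmod z < 1" for z :: complex
  proof -
    have "(\<lambda>n. - (z ^ n / of_nat n)) sums Ln (1 - z)"
      using Ln_series'[of "- z"] that by simp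
    then have "(\<lambda>n. z ^ n / of_nat n) sums - Ln (1 - z)"
      using sums_minus by fastforce
    then show ?thesis by (subst sums_Suc_iff) simp
  qed
  have lt: "cmod (\<alpha> * u) < 1" "cmod (\<beta> * u) < 1" using \<alpha>u \<beta>u u by simp_all
  have Re_pos: "0 < Re (1 - z)" if "cmod z < 1" for z
    using abs_Re_le_cmod[of z] that by simp
  have arg: "\<bar>Im (Ln (1 - z))\<bar> < pi / 2" if "cmod z < 1" for z
    by (rule Re_Ln_pos_lt_imp[OF Re_pos[OF that]])
  have "1 - \<alpha> * u \<noteq> 0" "1 - \<beta> * u \<noteq> 0"
    using Re_pos[OF lt(1)] Re_pos[OF lt(2)] by force+
  then have "Ln ((1 - \<alpha> * u) * (1 - \<beta> * u)) = Ln (1 - \<alpha> * u) + Ln (1 - \<beta> * u)"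
    using arg[OF lt(1)] arg[OF lt(2)] by (intro Ln_times_simple) (auto simp: abs_if split: if_splits)
  moreover have "(1 - \<alpha> * u) * (1 - \<beta> * u) = 1 - P * u + Q * u\<^sup>2"
    by (simp add: sum[symmetric] prod[symmetric] algebra_simps power2_eq_square)
  ultimately have Ln_eq: "Ln (1 - P * u + Q * u\<^sup>2) = Ln (1 - \<alpha> * u) + Ln (1 - \<beta> * u)" by simp
  have "(\<lambda>n. (\<alpha> * u) ^ Suc n / of_nat (Suc n) + (\<beta> * u) ^ Suc n / of_nat (Suc n)) sums
      (- Ln (1 - \<alpha> * u) + - Ln (1 - \<beta> * u))"
    by (intro sums_add ser lt)
  also have "(\<lambda>n. (\<alpha> * u) ^ Suc n / of_nat (Suc n) + (\<beta> * u) ^ Suc n / of_nat (Suc n)) =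
      (\<lambda>n. lucas_V P Q (Suc n) / of_nat (Suc n) * u ^ Suc n)"
    unfolding add_divide_distrib[symmetric] V[symmetric] by (simp add: mult_ac)
  finally show "(\<lambda>n. lucas_V P Q (Suc n) / of_nat (Suc n) * u ^ Suc n) sums
      - Ln (1 - P * u + Q * u\<^sup>2)"
    by (simp add: Ln_eq)
qed

lemma continuous_on_lucas_V [continuous_intros]:
  "continuous_on S f \<Longrightarrow> continuous_on S (\<lambda>s. lucas_V (f s) Q n)"
  by (induction n rule: induct_nat_012) (auto intro!: continuous_intros)

lemma integrable_continuous_mult:
  fixes h \<phi> :: "real \<Rightarrow> complex"
  assumes M: "sets M = sets borel" and h: "integrable M h"
    and K: "AE s in M. \<bar>s\<bar> \<le> K" and \<phi>: "continuous_on UNIV \<phi>"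
  shows "integrable M (\<lambda>s. \<phi> s * h s)"
proof -
  have "compact (\<phi> ` {-K..K})"
    using \<phi> by (intro compact_continuous_image) (auto intro: continuous_on_subset)
  then have "bounded (\<phi> ` {-K..K})" by (rule compact_imp_bounded)
  then obtain c where "\<forall>z\<in>\<phi> ` {-K..K}. cmod z \<le> c" unfolding bounded_iff by blast
  then have c: "cmod (\<phi> s) \<le> c" if "s \<in> {-K..K}" for s using that by blast
  have [measurable]: "\<phi> \<in> borel_measurable M" "h \<in> borel_measurable M"
    using borel_measurable_continuous_onI[OF \<phi>] borel_measurable_integrable[OF h]
    unfolding measurable_cong_sets[OF M refl] by simp_all
  show ?thesis
  proof (rule Bochner_Integration.integrable_bound[OF integrable_mult_right[OF h, of "of_real c"]])
    show "AE s in M. cmod (\<phi> s * h s) \<le> cmod (of_real c * h s)"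
      using K
    proof eventually_elim
      case (elim s)
      then have "s \<in> {-K..K}" by auto
      from c[OF this] have "cmod (\<phi> s) \<le> \<bar>c\<bar>" by linarith
      then show ?case by (simp add: norm_mult mult_right_mono)
    qed
  qed measurable
qed

text \<open>
  For \<open>\<bar>s\<bar> \<le> K\<close> the terms of the series are dominated by \<open>2\<^sup>-\<^sup>n \<bar>h s\<bar>\<close>, and summation and integration may
  be interchanged.
\<close>

lemma integral_lucas_V_log_series:
  fixes h :: "real \<Rightarrow> complex" and a Q u :: complex
  assumes M: "sets M = sets borel" and h: "integrable M h"
    and K: "AE s in M. \<bar>s\<bar> \<le> K"
    and L: "1 + (K + cmod a) + cmod Q \<le> L" and u: "2 * L * cmod u \<le> 1"
  defines "\<phi> \<equiv> \<lambda>s. Ln (1 - (a - of_real s) * u + Q * u\<^sup>2)"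
  shows "integrable M (\<lambda>s. h s * \<phi> s)"
    and "(\<lambda>n. (\<integral>s. lucas_V (a - of_real s) Q (Suc n) * h s \<partial>M) / of_nat (Suc n) * u ^ Suc n)
      sums - (\<integral>s. h s * \<phi> s \<partial>M)"
proof -
  define f where "f = (\<lambda>n s. (lucas_V (a - of_real s) Q (Suc n) / of_nat (Suc n) * u ^ Suc n) * h s)"
  have int_f: "integrable M (f n)" for n
    unfolding f_def by (rule integrable_continuous_mult[OF M h K]) (auto intro!: continuous_intros simp del: of_nat_Suc)
  have [measurable]: "Ln \<in> borel_measurable borel" by (rule Ln_measurable)
  have "\<phi> \<in> borel_measurable borel" unfolding \<phi>_def by measurable
  then have [measurable]: "\<phi> \<in> borel_measurable M" "h \<in> borel_measurable M"
    using borel_measurable_integrable[OF h] unfolding measurable_cong_sets[OF M refl] by simp_all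
  have point: "(\<lambda>n. f n s) sums (- \<phi> s * h s) \<and> (\<forall>n. norm (f n s) \<le> (1/2) ^ n * cmod (h s))"
    if s: "\<bar>s\<bar> \<le> K" for s
  proof -
    have "cmod (a - of_real s) \<le> cmod a + \<bar>s\<bar>"
      using norm_triangle_ineq4[of a "of_real s"] by simp
    then have L': "1 + cmod (a - of_real s) + cmod Q \<le> L" using L s by simp
    have u': "L * cmod u \<le> 1/2" using u by simp
    have L0: "0 \<le> L" using L' by (smt (verit) norm_ge_zero)
    have u1: "L * cmod u < 1" using u' by simp
    note ser = lucas_V_log_series[OF L' u1]
    have "(\<lambda>n. f n s) sums (- \<phi> s * h s)"
      unfolding f_def \<phi>_def by (intro sums_mult2 ser(1))
    moreover have "norm (f n s) \<le> (1/2) ^ n * cmod (h s)" for n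
    proof -
      have "norm (f n s) = cmod (lucas_V (a - of_real s) Q (Suc n) * u ^ Suc n) / real (Suc n) * cmod (h s)"
        unfolding f_def by (simp add: norm_mult norm_divide del: lucas_V.simps of_nat_Suc)
      also have "\<dots> \<le> cmod (lucas_V (a - of_real s) Q (Suc n) * u ^ Suc n) * cmod (h s)"
        by (intro mult_right_mono) (auto simp: divide_le_eq mult_left_le_one_le mult_le_cancel_left1 simp del: lucas_V.simps)
      also have "\<dots> \<le> (2 * (L * cmod u) ^ Suc n) * cmod (h s)"
        by (intro mult_right_mono ser(2)) simp
      also have "\<dots> \<le> (2 * (1/2) ^ Suc n) * cmod (h s)"
        using u' L0 by (intro mult_right_mono mult_left_mono power_mono) auto
      finally show ?thesis by simp
    qed
    ultimately show ?thesis by blast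
  qed
  have geo: "summable (\<lambda>n. (1/2) ^ n * c)" for c :: real
    by (intro summable_mult2 summable_geometric) auto
  have ae_sum: "AE s in M. summable (\<lambda>n. norm (f n s))"
    using K
  proof eventually_elim
    case (elim s)
    show ?case
      using point[OF elim] by (intro summable_comparison_test'[OF geo[of "cmod (h s)"]]) auto
  qed
  have "summable (\<lambda>n. \<integral>s. norm (f n s) \<partial>M)"
  proof (rule summable_comparison_test'[OF geo[of "\<integral>s. cmod (h s) \<partial>M"], of 0])
    fix n
    have "(\<integral>s. norm (f n s) \<partial>M) \<le> (\<integral>s. (1/2) ^ n * cmod (h s) \<partial>M)"
      using int_f h K point by (intro integral_mono_AE) auto
    then show "norm (\<integral>s. norm (f n s) \<partial>M) \<le> (1/2) ^ n * (\<integral>s. cmod (h s) \<partial>M)"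
      by simp
  qed
  note dom = integrable_suminf[OF int_f ae_sum this] sums_integral[OF int_f ae_sum this]
  have ae_eq: "AE s in M. (\<Sum>n. f n s) = - (h s * \<phi> s)"
    using K by eventually_elim (use point in \<open>auto simp: sums_iff mult.commute\<close>)
  have "integrable M (\<lambda>s. - (h s * \<phi> s))"
    using dom(1) by (rule Bochner_Integration.integrable_cong_AE_imp) (use ae_eq in \<open>auto simp: eq_commute\<close>)
  then show "integrable M (\<lambda>s. h s * \<phi> s)"
    using integrable_minus by fastforce
  have "(\<integral>s. (\<Sum>n. f n s) \<partial>M) = - (\<integral>s. h s * \<phi> s \<partial>M)"
    unfolding Bochner_Integration.integral_minus[symmetric]
    using dom(1) ae_eq by (intro integral_cong_AE) auto
  moreover have "(\<integral>s. f n s \<partial>M) =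
      (\<integral>s. lucas_V (a - of_real s) Q (Suc n) * h s \<partial>M) / of_nat (Suc n) * u ^ Suc n" for n
    unfolding f_def
    by (subst integral_divide_zero[symmetric], subst integral_mult_left_zero[symmetric])
      (simp add: mult_ac del: lucas_V.simps)
  ultimately show "(\<lambda>n. (\<integral>s. lucas_V (a - of_real s) Q (Suc n) * h s \<partial>M) / of_nat (Suc n) * u ^ Suc n)
      sums - (\<integral>s. h s * \<phi> s \<partial>M)"
    using dom(2) by simp
qed

text \<open>
  The two recurrences for \<open>F\<close> say that \<open>F m = V\<^sub>m(a - T, Q) \<delta>\<close> for \<open>F 0 = 2 \<delta>\<close>. They are solved for
  \<open>T (F m)\<close> in order to show that \<open>T\<close> preserves finite support along the sequence.
\<close>

lemma (in l2_resolution) lucas_V_spectral_density: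
  fixes F :: "nat \<Rightarrow> 'v \<Rightarrow> complex"
  assumes T: "\<And>f g. f \<in> l2 V \<Longrightarrow> g \<in> l2 V \<Longrightarrow>
      l2_inner V (T f) g = cmeasure_integral (\<lambda>B. l2_inner V (E B f) g) of_real"
    and F: "\<And>m. F m \<in> finsupp V" and g: "g \<in> finsupp V" and M: "sets M = sets borel"
    and F1: "T (F 0) = (\<lambda>v. a * F 0 v - 2 * F 1 v)"
    and F2: "\<And>m. T (F (Suc m)) = (\<lambda>v. a * F (Suc m) v - (F (Suc (Suc m)) v + Q * F m v))"
    and F0: "has_spectral_density M g (F 0) (\<lambda>s. 2 * h s)"
    and h: "\<And>\<phi>. continuous_on UNIV \<phi> \<Longrightarrow> integrable M (\<lambda>s. \<phi> s * h s)"
  shows "has_spectral_density M g (F m) (\<lambda>s. lucas_V (a - of_real s) Q m * h s)"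
proof -
  have TF: "T (F m) \<in> finsupp V" for m
  proof (cases m)
    case 0
    then show ?thesis using finsupp_lincomb[OF F F, of a 0 "- 2" 1] F1 by simp
  next
    case (Suc j)
    then show ?thesis
      using finsupp_lincomb[OF F finsupp_lincomb[OF F F], of a "Suc j" "- 1" 1 "Suc (Suc j)" Q j]
      by (simp add: F2 Suc algebra_simps)
  qed
  have shift: "has_spectral_density M g (\<lambda>v. a * F m v + - 1 * T (F m) v)
      (\<lambda>s. a * (lucas_V (a - of_real s) Q m * h s) +
        - 1 * (of_real s * (lucas_V (a - of_real s) Q m * h s)))"
    if "has_spectral_density M g (F m) (\<lambda>s. lucas_V (a - of_real s) Q m * h s)" for m
  proof -
    have "integrable M (\<lambda>s. (of_real s * lucas_V (a - of_real s) Q m) * h s)"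
      by (intro h continuous_intros)
    then have int: "integrable M (\<lambda>s. of_real s * (lucas_V (a - of_real s) Q m * h s))"
      by (simp add: mult.assoc)
    have "has_spectral_density M g (T (F m)) (\<lambda>s. of_real s * (lucas_V (a - of_real s) Q m * h s))"
      by (rule has_spectral_density_operator[OF T finsupp_l2[OF F] finsupp_l2[OF TF] finsupp_l2[OF g] M that int])
    then show ?thesis
      by (rule has_spectral_density_lincomb[OF M F TF g that])
  qed
  show ?thesis
  proof (induction m rule: induct_nat_012)
    case 0
    then show ?case using F0 by simp
  next
    case 1
    have "has_spectral_density M g (\<lambda>v. 1/2 * (a * F 0 v + - 1 * T (F 0) v) + 0 * F 0 v)
        (\<lambda>s. 1/2 * (a * (lucas_V (a - of_real s) Q 0 * h s) +
          - 1 * (of_real s * (lucas_V (a - of_real s) Q 0 * h s))) + 0 * (2 * h s))"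
      by (intro has_spectral_density_lincomb shift finsupp_lincomb F TF g M F0) (use F0 in simp)
    then show ?case by (simp add: F1 algebra_simps)
  next
    case (ge2 m)
    have "has_spectral_density M g (\<lambda>v. 1 * (a * F (Suc m) v + - 1 * T (F (Suc m)) v) + (- Q) * F m v)
        (\<lambda>s. 1 * (a * (lucas_V (a - of_real s) Q (Suc m) * h s) +
          - 1 * (of_real s * (lucas_V (a - of_real s) Q (Suc m) * h s))) +
          (- Q) * (lucas_V (a - of_real s) Q m * h s))"
      by (intro has_spectral_density_lincomb shift finsupp_lincomb F TF g M ge2)
    then show ?case by (simp add: F2 algebra_simps)
  qed
qed

section \<open>Geodesics in a regular graph\<close>

locale regular_bidirected_digraph = bidirected_digraph G arev
  for G :: "('v, 'e) pre_digraph" and arev :: "'e \<Rightarrow> 'e" +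
  fixes q :: nat
  assumes regular: "regular_graph (q + 1) G"
begin

lemma out_arcs_outside: "v \<notin> verts G \<Longrightarrow> out_arcs G v = {}"
  by auto

lemma finite_out_arcs [simp]: "finite (out_arcs G v)"
  using regular out_arcs_outside[of v] by (cases "v \<in> verts G") (auto simp: regular_graph_def)

lemma card_out_arcs: "v \<in> verts G \<Longrightarrow> card (out_arcs G v) = q + 1"
  using regular by (auto simp: regular_graph_def out_degree_def)

text \<open>
  Reversal turns the terminus of an edge into its origin, and every vertex is the origin of \<open>q + 1\<close>
  edges.
\<close>

lemma sum_heads_le:
  fixes w :: "'v \<Rightarrow> real"
  assumes w: "\<And>v. 0 \<le> w v" "w summable_on verts G" and F: "finite F"
  shows "(\<Sum>v\<in>F. \<Sum>e\<in>out_arcs G v. w (head G e)) \<le> (real q + 1) * (\<Sum>\<^sub>\<infinity>v\<in>verts G. w v)"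
proof -
  define S where "S = (\<Union>v\<in>F. out_arcs G v)"
  define F' where "F' = head G ` S"
  have S: "finite S" "S \<subseteq> arcs G" using F by (auto simp: S_def)
  then have F': "finite F'" "F' \<subseteq> verts G" by (auto simp: F'_def)
  have "(\<Sum>v\<in>F. \<Sum>e\<in>out_arcs G v. w (head G e)) = (\<Sum>e\<in>S. w (head G e))"
    unfolding S_def using F by (intro sum.UNION_disjoint[symmetric]) auto
  also have "\<dots> = (\<Sum>e\<in>S. w (tail G (arev e)))"
    using S by (intro sum.cong) auto
  also have "\<dots> = (\<Sum>e\<in>arev ` S. w (tail G e))"
    by (subst sum.reindex) auto
  also have "\<dots> \<le> (\<Sum>e\<in>(\<Union>v\<in>F'. out_arcs G v). w (tail G e))"
  proof (rule sum_mono2)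
    show "arev ` S \<subseteq> (\<Union>v\<in>F'. out_arcs G v)"
    proof
      fix e assume "e \<in> arev ` S"
      then obtain a where "a \<in> S" "a \<in> arcs G" "e = arev a" using S by auto
      then show "e \<in> (\<Union>v\<in>F'. out_arcs G v)" by (auto simp: F'_def)
    qed
  qed (use F' w in auto)
  also have "\<dots> = (\<Sum>v\<in>F'. \<Sum>e\<in>out_arcs G v. w (tail G e))"
    using F' by (intro sum.UNION_disjoint) auto
  also have "\<dots> = (\<Sum>v\<in>F'. (real q + 1) * w v)"
  proof (intro sum.cong refl)
    fix v assume "v \<in> F'"
    then have "card (out_arcs G v) = q + 1" using F' card_out_arcs by auto
    then show "(\<Sum>e\<in>out_arcs G v. w (tail G e)) = (real q + 1) * w v" by simp
  qed
  also have "\<dots> = (real q + 1) * (\<Sum>v\<in>F'. w v)" by (simp add: sum_distrib_left)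
  also have "\<dots> \<le> (real q + 1) * (\<Sum>\<^sub>\<infinity>v\<in>verts G. w v)"
    using F' w by (intro mult_left_mono finite_sum_le_infsum) auto
  finally show ?thesis .
qed

text \<open>
  On an edge from \<open>v\<close> to \<open>w\<close>, \<open>2 \<bar>f(v)\<bar> \<bar>f(w)\<bar> \<le> \<bar>f(v)\<bar>\<^sup>2 + \<bar>f(w)\<bar>\<^sup>2\<close>, and each of the two squares,
  summed over all edges, contributes \<open>(q + 1) \<parallel>f\<parallel>\<^sup>2\<close>.
\<close>

lemma laplacian_numerical_bound:
  assumes f: "f \<in> l2 (verts G)"
  shows "cmod (l2_inner (verts G) (laplacian q G f) f) \<le>
    2 * (real q + 1) * Re (l2_inner (verts G) f f)"
proof -
  let ?w = "\<lambda>v. (cmod (f v))\<^sup>2"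
  let ?W = "\<Sum>\<^sub>\<infinity>v\<in>verts G. ?w v"
  let ?g = "\<lambda>v. \<Sum>e\<in>out_arcs G v. ?w (head G e)"
  let ?b = "\<lambda>v. 3/2 * (real q + 1) * ?w v + 1/2 * ?g v"
  have w: "?w summable_on verts G" using f by (simp add: l2_def)
  have W: "Re (l2_inner (verts G) f f) = ?W" using l2_inner_self[OF f] by simp
  have fin: "sum ?g F \<le> (real q + 1) * ?W" if "finite F" for F
    using sum_heads_le[of ?w F] w that by simp
  have g: "?g summable_on verts G"
    using fin by (intro nonneg_bdd_above_summable_on bdd_aboveI2 sum_nonneg) auto
  then have "infsum ?g (verts G) \<le> (real q + 1) * ?W"
    using fin by (rule infsum_le_finite_sums)
  have b1: "(\<lambda>v. 3/2 * (real q + 1) * ?w v) summable_on verts G"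
    using w by (rule summable_on_cmult_right)
  have b2: "(\<lambda>v. 1/2 * ?g v) summable_on verts G"
    using g by (rule summable_on_cmult_right)
  have b: "?b summable_on verts G"
    using b1 b2 by (rule summable_on_add)
  have pw: "cmod (laplacian q G f v * cnj (f v)) \<le> ?b v" if v: "v \<in> verts G" for v
  proof -
    have "cmod (laplacian q G f v * cnj (f v)) \<le>
        ((real q + 1) * cmod (f v) + (\<Sum>e\<in>out_arcs G v. cmod (f (head G e)))) * cmod (f v)"
    proof -
      have "cmod (laplacian q G f v) \<le>
          cmod ((of_nat q + 1) * f v) + cmod (\<Sum>e\<in>out_arcs G v. f (head G e))"
        unfolding laplacian_def by (rule norm_triangle_ineq4)
      also have "\<dots> \<le> (real q + 1) * cmod (f v) + (\<Sum>e\<in>out_arcs G v. cmod (f (head G e)))"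
      proof (intro add_mono norm_sum)
        have "cmod (of_nat q + 1) = real q + 1"
          by (metis norm_of_nat of_nat_Suc Suc_eq_plus1 of_nat_add of_nat_1)
        then show "cmod ((of_nat q + 1) * f v) \<le> (real q + 1) * cmod (f v)"
          by (simp add: norm_mult)
      qed
      finally show ?thesis by (simp add: norm_mult mult_right_mono)
    qed
    also have "\<dots> = (real q + 1) * ?w v + (\<Sum>e\<in>out_arcs G v. cmod (f (head G e)) * cmod (f v))"
      by (simp add: power2_eq_square distrib_right sum_distrib_right mult.assoc)
    also have "\<dots> \<le> (real q + 1) * ?w v + (\<Sum>e\<in>out_arcs G v. 1/2 * ?w (head G e) + 1/2 * ?w v)"
    proof (intro add_left_mono sum_mono)
      fix e
      have "0 \<le> (cmod (f (head G e)) - cmod (f v))\<^sup>2" by simp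
      then show "cmod (f (head G e)) * cmod (f v) \<le> 1/2 * ?w (head G e) + 1/2 * ?w v"
        by (simp add: power2_diff)
    qed
    also have "\<dots> = ?b v"
      using card_out_arcs[OF v]
      by (simp add: sum.distrib sum_distrib_left[symmetric] sum_divide_distrib[symmetric] field_simps)
    finally show ?thesis .
  qed
  have "cmod (l2_inner (verts G) (laplacian q G f) f) \<le> infsum ?b (verts G)"
    unfolding l2_inner_def
  proof (rule norm_infsum_le[OF has_sum_infsum has_sum_infsum[OF b] pw])
    show "(\<lambda>v. laplacian q G f v * cnj (f v)) summable_on verts G"
      by (rule abs_summable_summable, rule summable_on_comparison_test[OF b]) (use pw in auto)
  qed
  also have "\<dots> = 3/2 * (real q + 1) * ?W + 1/2 * infsum ?g (verts G)"
    unfolding infsum_add[OF b1 b2] infsum_cmult_right' ..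
  also have "\<dots> \<le> 2 * (real q + 1) * ?W"
    using \<open>infsum ?g (verts G) \<le> (real q + 1) * ?W\<close> by (simp only: mult.assoc)
  finally show ?thesis by (simp add: W)
qed

definition geods :: "'v \<Rightarrow> nat \<Rightarrow> 'v \<Rightarrow> 'e list set" where
  "geods x0 m v = {p. geodesic G arev x0 p v \<and> length p = m}"

lemma card_geods: "card (geods x0 m v) = geod_count G arev x0 m v"
  by (simp add: geods_def geod_count_def)

lemma backtracking_snoc:
  "backtracking arev (p @ [e]) \<longleftrightarrow> backtracking arev p \<or> (p \<noteq> [] \<and> e = arev (last p))"
proof -
  have "backtracking arev (p @ [e]) \<longleftrightarrow>
      (\<exists>i. Suc i < length p \<and> p ! Suc i = arev (p ! i)) \<or>
      (\<exists>i. Suc i = length p \<and> e = arev (p ! i))"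
  proof -
    have "Suc i < length (p @ [e]) \<and> (p @ [e]) ! Suc i = arev ((p @ [e]) ! i) \<longleftrightarrow>
        (Suc i < length p \<and> p ! Suc i = arev (p ! i)) \<or> (Suc i = length p \<and> e = arev (p ! i))" for i
      by (cases "Suc i < length p"; cases "Suc i = length p") (simp_all add: nth_append)
    then show ?thesis unfolding backtracking_def by (simp only: ex_disj_distrib)
  qed
  also have "(\<exists>i. Suc i = length p \<and> e = arev (p ! i)) \<longleftrightarrow> p \<noteq> [] \<and> e = arev (last p)"
    by (cases p rule: rev_cases) (auto simp: nth_append)
  finally show ?thesis by (simp add: backtracking_def)
qed

lemma geodesic_snoc:
  "geodesic G arev x0 (p @ [e]) v \<longleftrightarrow>
    geodesic G arev x0 p (tail G e) \<and> e \<in> arcs G \<and> head G e = v \<and> (p \<noteq> [] \<longrightarrow> e \<noteq> arev (last p))"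
proof -
  have "cas x0 (p @ [e]) v \<longleftrightarrow> cas x0 p (tail G e) \<and> head G e = v"
    by (induction p arbitrary: x0) auto
  then show ?thesis
    by (auto simp: geodesic_def awalk_def backtracking_snoc)
qed

lemma geods_end: "p \<in> geods x0 m v \<Longrightarrow> v \<in> verts G"
  by (auto simp: geods_def geodesic_def dest: awalk_last_in_verts)

lemma geods_0: "x0 \<in> verts G \<Longrightarrow> geods x0 0 v = (if v = x0 then {[]} else {})"
  by (auto simp: geods_def geodesic_def awalk_Nil_iff backtracking_def)

lemma snoc_in_geods:
  "p @ [e] \<in> geods x0 (Suc m) v \<longleftrightarrow>
    p \<in> geods x0 m (tail G e) \<and> e \<in> arcs G \<and> head G e = v \<and> (p \<noteq> [] \<longrightarrow> e \<noteq> arev (last p))"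
  by (auto simp: geods_def geodesic_snoc)

lemma singleton_in_geods:
  "[e] \<in> geods x0 (Suc m) v \<longleftrightarrow> [] \<in> geods x0 m (tail G e) \<and> e \<in> arcs G \<and> head G e = v"
  using snoc_in_geods[of "[]" e] by simp

lemma geods_Suc:
  "geods x0 (Suc m) v =
    (\<lambda>(e, p). p @ [arev e]) `
      {(e, p) \<in> Sigma (out_arcs G v) (\<lambda>e. geods x0 m (head G e)). \<not> (p \<noteq> [] \<and> last p = e)}"
    (is "_ = ?f ` ?A")
proof (intro equalityI subsetI)
  fix p assume p: "p \<in> geods x0 (Suc m) v"
  then obtain p' e where p_eq: "p = p' @ [e]"
    by (cases p rule: rev_cases) (auto simp: geods_def)
  have "(arev e, p') \<in> ?A"
    using p unfolding p_eq snoc_in_geods by auto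
  moreover have "p = ?f (arev e, p')" by (simp add: p_eq)
  ultimately show "p \<in> ?f ` ?A" by blast
next
  fix p assume "p \<in> ?f ` ?A"
  then show "p \<in> geods x0 (Suc m) v"
    by (auto simp: snoc_in_geods singleton_in_geods arev_eq_iff)
qed

lemma finite_geods [simp]: "finite (geods x0 m v)"
proof (induction m arbitrary: v)
  case 0
  have "geods x0 0 v \<subseteq> {[]}" by (auto simp: geods_def)
  then show ?case by (rule finite_subset) simp
next
  case (Suc m)
  then have fin: "finite (Sigma (out_arcs G v) (\<lambda>e. geods x0 m (head G e)))" by simp
  show ?case unfolding geods_Suc
    by (intro finite_imageI finite_subset[OF _ fin]) auto
qed

text \<open>
  A geodesic to a neighbour of \<open>v\<close> is extended to \<open>v\<close> by the reverse of the edge from \<open>v\<close> to that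
  neighbour. The second term counts the pairs for which this extension backtracks.
\<close>

lemma geods_neighbours:
  "(\<Sum>e\<in>out_arcs G v. card (geods x0 m (head G e))) =
    card (geods x0 (Suc m) v) +
    card {(e, p) \<in> Sigma (out_arcs G v) (\<lambda>e. geods x0 m (head G e)). p \<noteq> [] \<and> last p = e}"
proof -
  let ?S = "Sigma (out_arcs G v) (\<lambda>e. geods x0 m (head G e))"
  let ?A = "{(e, p) \<in> ?S. \<not> (p \<noteq> [] \<and> last p = e)}"
  let ?B = "{(e, p) \<in> ?S. p \<noteq> [] \<and> last p = e}"
  have fin: "finite ?S" by (intro finite_SigmaI) auto
  have "(\<Sum>e\<in>out_arcs G v. card (geods x0 m (head G e))) = card ?S" by simp
  also have "?S = ?A \<union> ?B" by auto
  also have "card (?A \<union> ?B) = card ?A + card ?B"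
    by (intro card_Un_disjoint finite_subset[OF _ fin]) auto
  also have "card ?A = card (geods x0 (Suc m) v)"
    unfolding geods_Suc by (intro card_image[symmetric]) (auto simp: inj_on_def arev_eq_iff)
  finally show ?thesis .
qed

lemma geods_backtracking:
  "{(e, p) \<in> Sigma (out_arcs G v) (\<lambda>e. geods x0 (Suc m) (head G e)). p \<noteq> [] \<and> last p = e} =
    (\<lambda>(p, e). (e, p @ [e])) `
      Sigma (geods x0 m v) (\<lambda>p. {e \<in> out_arcs G v. p \<noteq> [] \<longrightarrow> e \<noteq> arev (last p)})"
    (is "?B = ?f ` ?S")
proof (intro equalityI subsetI)
  fix x assume "x \<in> ?B"
  then obtain e p where x: "x = (e, p)" "e \<in> out_arcs G v" "p \<in> geods x0 (Suc m) (head G e)"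
      "p \<noteq> []" "last p = e" by auto
  then obtain p' where p: "p = p' @ [e]" by (metis append_butlast_last_id)
  have "(p', e) \<in> ?S" using x(2,3) unfolding p snoc_in_geods by auto
  moreover have "x = ?f (p', e)" using x p by simp
  ultimately show "x \<in> ?f ` ?S" by blast
next
  fix x assume "x \<in> ?f ` ?S"
  then show "x \<in> ?B" by (auto simp: snoc_in_geods singleton_in_geods)
qed

text \<open>
  Backtracking pairs arise by going from \<open>v\<close> one step further and returning. All edges at \<open>v\<close> except
  the reverse of the last one may be used for this step; the empty path excludes none.
\<close>

lemma card_geods_backtracking:
  "card {(e, p) \<in> Sigma (out_arcs G v) (\<lambda>e. geods x0 (Suc m) (head G e)). p \<noteq> [] \<and> last p = e} =
    (if m = 0 then q + 1 else q) * card (geods x0 m v)"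
proof -
  let ?X = "\<lambda>p. {e \<in> out_arcs G v. p \<noteq> [] \<longrightarrow> e \<noteq> arev (last p)}"
  have X: "card (?X p) = (if m = 0 then q + 1 else q)" if p: "p \<in> geods x0 m v" for p
  proof -
    have v: "v \<in> verts G" by (rule geods_end[OF p])
    show ?thesis
    proof (cases m)
      case 0
      then have X_eq: "?X p = out_arcs G v" using p by (auto simp: geods_def)
      show ?thesis unfolding X_eq using 0 card_out_arcs[OF v] by simp
    next
      case (Suc j)
      then obtain p' e where pe: "p = p' @ [e]"
        using p by (cases p rule: rev_cases) (auto simp: geods_def)
      have "arev e \<in> out_arcs G v"
        using p unfolding pe Suc snoc_in_geods by auto
      moreover have "?X p = out_arcs G v - {arev e}" by (auto simp: pe)
      ultimately show ?thesis using card_out_arcs[OF v] Suc by simp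
    qed
  qed
  have "card ((\<lambda>(p, e). (e, p @ [e])) ` Sigma (geods x0 m v) ?X) = card (Sigma (geods x0 m v) ?X)"
    by (rule card_image) (auto simp: inj_on_def)
  also have "\<dots> = (\<Sum>p\<in>geods x0 m v. card (?X p))"
    by (rule card_SigmaI) (auto intro: finite_subset[OF _ finite_out_arcs[of v]])
  also have "\<dots> = (\<Sum>p\<in>geods x0 m v. if m = 0 then q + 1 else q)"
    by (rule sum.cong[OF refl X])
  finally show ?thesis unfolding geods_backtracking by simp
qed

lemma geod_count_neighbours:
  "(\<Sum>e\<in>out_arcs G v. geod_count G arev x0 0 (head G e)) = geod_count G arev x0 1 v"
  "(\<Sum>e\<in>out_arcs G v. geod_count G arev x0 (Suc m) (head G e)) =
    geod_count G arev x0 (Suc (Suc m)) v + (if m = 0 then q + 1 else q) * geod_count G arev x0 m v"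
proof -
  have "{(e, p) \<in> Sigma (out_arcs G v) (\<lambda>e. geods x0 0 (head G e)). p \<noteq> [] \<and> last p = e} = {}"
    by (auto simp: geods_def)
  then have "card {(e, p) \<in> Sigma (out_arcs G v) (\<lambda>e. geods x0 0 (head G e)). p \<noteq> [] \<and> last p = e} = 0"
    by (metis card.empty)
  then show "(\<Sum>e\<in>out_arcs G v. geod_count G arev x0 0 (head G e)) = geod_count G arev x0 1 v"
    using geods_neighbours[of x0 0 v] by (simp add: card_geods)
  show "(\<Sum>e\<in>out_arcs G v. geod_count G arev x0 (Suc m) (head G e)) =
    geod_count G arev x0 (Suc (Suc m)) v + (if m = 0 then q + 1 else q) * geod_count G arev x0 m v"
    using geods_neighbours[of x0 "Suc m" v] card_geods_backtracking[of v x0 m]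
    by (simp add: card_geods)
qed

lemma geod_count_finite_support: "finite {v. geod_count G arev x0 m v \<noteq> 0}"
proof -
  have "finite {v. geods x0 m v \<noteq> {}}"
  proof (induction m)
    case 0
    have "{v. geods x0 0 v \<noteq> {}} \<subseteq> {x0}"
      by (auto simp: geods_def geodesic_def awalk_Nil_iff)
    then show ?case by (rule finite_subset) simp
  next
    case (Suc m)
    have sub: "{v. geods x0 (Suc m) v \<noteq> {}} \<subseteq> (\<Union>w\<in>{v. geods x0 m v \<noteq> {}}. head G ` out_arcs G w)"
    proof
      fix v assume "v \<in> {v. geods x0 (Suc m) v \<noteq> {}}"
      then obtain p where p: "p \<in> geods x0 (Suc m) v" by auto
      then obtain p' e where pe: "p = p' @ [e]"
        by (cases p rule: rev_cases) (auto simp: geods_def)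
      show "v \<in> (\<Union>w\<in>{v. geods x0 m v \<noteq> {}}. head G ` out_arcs G w)"
        using p unfolding pe snoc_in_geods by force
    qed
    show ?case by (rule finite_subset[OF sub], rule finite_UN_I[OF Suc]) auto
  qed
  then show ?thesis
    by (rule rev_finite_subset) (auto simp: card_geods[symmetric])
qed

lemma geod_count_outside: "v \<notin> verts G \<Longrightarrow> geod_count G arev x0 m v = 0"
  using geods_end[of _ x0 m v] by (auto simp: card_geods[symmetric])

lemma geod_count_0: "x0 \<in> verts G \<Longrightarrow> geod_count G arev x0 0 v = indicator {x0} v"
  by (simp add: card_geods[symmetric] geods_0)

definition geod_tail :: "'v \<Rightarrow> nat \<Rightarrow> 'v \<Rightarrow> int" where
  "geod_tail x0 m v = (\<Sum>j = 1..m div 2. int (geod_count G arev x0 (m - 2 * j) v))"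

lemma geod_coeff_eq:
  "geod_coeff q G arev x0 m v = int (geod_count G arev x0 m v) - (int q - 1) * geod_tail x0 m v"
  by (simp add: geod_coeff_def geod_tail_def)

lemma geod_tail_simps [simp]:
  "geod_tail x0 0 v = 0"
  "geod_tail x0 (Suc 0) v = 0"
  "geod_tail x0 (Suc (Suc m)) v = int (geod_count G arev x0 m v) + geod_tail x0 m v"
proof -
  have "geod_tail x0 (Suc (Suc m)) v =
      (\<Sum>j\<in>Suc ` {0..m div 2}. int (geod_count G arev x0 (Suc (Suc m) - 2 * j) v))"
    unfolding geod_tail_def by (intro sum.cong) (auto simp: image_Suc_atLeastAtMost)
  also have "\<dots> = (\<Sum>j = 0..m div 2. int (geod_count G arev x0 (m - 2 * j) v))"
    by (subst sum.reindex) auto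
  also have "\<dots> = int (geod_count G arev x0 m v) + geod_tail x0 m v"
    unfolding geod_tail_def by (subst sum.atLeast_Suc_atMost) auto
  finally show "geod_tail x0 (Suc (Suc m)) v = int (geod_count G arev x0 m v) + geod_tail x0 m v" .
qed (simp_all add: geod_tail_def)

lemma int_geod_count_neighbours:
  "(\<Sum>e\<in>out_arcs G v. int (geod_count G arev x0 0 (head G e))) = int (geod_count G arev x0 1 v)"
  "(\<Sum>e\<in>out_arcs G v. int (geod_count G arev x0 (Suc m) (head G e))) =
    int (geod_count G arev x0 (Suc (Suc m)) v) +
    (if m = 0 then int q + 1 else int q) * int (geod_count G arev x0 m v)"
  by (simp_all add: of_nat_sum[symmetric] geod_count_neighbours del: of_nat_sum)

text \<open>
  The surplus \<open>c\<^sub>0\<close> that the exceptional factor \<open>q + 1\<close> produces at \<open>c\<^sub>1\<close> is exactly the new last summand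
  of the longer sum, so the sums satisfy the regular recurrence from degree 2 on.
\<close>

lemma geod_tail_neighbours:
  "(\<Sum>e\<in>out_arcs G v. geod_tail x0 (Suc (Suc m)) (head G e)) =
    geod_tail x0 (Suc (Suc (Suc m))) v + int q * geod_tail x0 (Suc m) v"
proof (induction m rule: induct_nat_012)
  case 0
  then show ?case using int_geod_count_neighbours(1) by simp
next
  case 1
  then show ?case using int_geod_count_neighbours(2)[where ?x0.0 = x0 and m = 0]
    by (simp add: algebra_simps)
next
  case (ge2 m)
  have "(\<Sum>e\<in>out_arcs G v. geod_tail x0 (Suc (Suc (Suc (Suc m)))) (head G e)) =
      (\<Sum>e\<in>out_arcs G v. int (geod_count G arev x0 (Suc (Suc m)) (head G e))) +
      (\<Sum>e\<in>out_arcs G v. geod_tail x0 (Suc (Suc m)) (head G e))"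
    by (simp only: geod_tail_simps(3)[where m = "Suc (Suc m)"] sum.distrib)
  then show ?case
    unfolding ge2 int_geod_count_neighbours by (simp add: algebra_simps)
qed

text \<open>
  In degree 0 the value is doubled, as \<open>V\<^sub>0 = 2\<close>; this makes the recurrence below hold from the start.
\<close>

definition geod_vec :: "'v \<Rightarrow> nat \<Rightarrow> 'v \<Rightarrow> int" where
  "geod_vec x0 m v =
    (if m = 0 then 2 * int (geod_count G arev x0 0 v) else geod_coeff q G arev x0 m v)"

lemma geod_vec_1:
  "2 * geod_vec x0 1 v = (\<Sum>e\<in>out_arcs G v. geod_vec x0 0 (head G e))"
  by (simp add: geod_vec_def geod_coeff_eq int_geod_count_neighbours[simplified] flip: sum_distrib_left)

lemma geod_vec_Suc_Suc:
  "geod_vec x0 (Suc (Suc m)) v =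
    (\<Sum>e\<in>out_arcs G v. geod_vec x0 (Suc m) (head G e)) - int q * geod_vec x0 m v"
proof (cases m)
  case 0
  then show ?thesis
    using int_geod_count_neighbours(2)[where v = v and ?x0.0 = x0 and m = 0]
    by (simp add: geod_vec_def geod_coeff_eq algebra_simps)
next
  case (Suc j)
  have "(\<Sum>e\<in>out_arcs G v. geod_vec x0 (Suc m) (head G e)) =
      (\<Sum>e\<in>out_arcs G v. int (geod_count G arev x0 (Suc m) (head G e))) -
      (int q - 1) * (\<Sum>e\<in>out_arcs G v. geod_tail x0 (Suc (Suc j)) (head G e))"
    by (simp add: geod_vec_def geod_coeff_eq sum_subtractf sum_distrib_left Suc)
  then show ?thesis
    unfolding geod_tail_neighbours int_geod_count_neighbours
    by (simp add: geod_vec_def geod_coeff_eq Suc algebra_simps)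
qed

lemma geod_vec_finsupp: "(\<lambda>v. complex_of_int (geod_vec x0 m v)) \<in> finsupp (verts G)"
proof -
  let ?S = "\<Union>j\<in>{..m}. {v. geod_count G arev x0 j v \<noteq> 0}"
  have fin: "finite ?S" using geod_count_finite_support by simp
  have sub: "{v. complex_of_int (geod_vec x0 m v) \<noteq> 0} \<subseteq> ?S"
  proof (rule subsetI, rule ccontr)
    fix v assume v: "v \<in> {v. complex_of_int (geod_vec x0 m v) \<noteq> 0}" and "v \<notin> ?S"
    then have "geod_count G arev x0 j v = 0" if "j \<le> m" for j using that by simp
    then have "geod_vec x0 m v = 0" by (simp add: geod_vec_def geod_coeff_def)
    then show False using v by simp
  qed
  have "?S \<subseteq> verts G"
  proof
    fix v assume "v \<in> ?S"
    then obtain j where "geod_count G arev x0 j v \<noteq> 0" by auto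
    then show "v \<in> verts G" using geod_count_outside[of v x0 j] by (cases "v \<in> verts G") simp_all
  qed
  then show ?thesis
    unfolding finsupp_def using finite_subset[OF sub fin] sub by simp
qed

end

section \<open>The zeta function\<close>

theorem mainTheorem4:
  fixes q :: nat
    and G :: "('v, 'e) pre_digraph"
    and arev :: "'e \<Rightarrow> 'e"
    and x0 x :: 'v
    and E :: "real set \<Rightarrow> ('v \<Rightarrow> complex) \<Rightarrow> ('v \<Rightarrow> complex)"
  assumes "q > 0"
    and "bidirected_digraph G arev"
    and "regular_graph (q + 1) G"
    and "infinite (verts G)"
    and "x0 \<in> verts G"
    and "x \<in> verts G"
    and "spectral_resolution (verts G) (laplacian q G) E"
  shows "\<exists>r>0. \<forall>u::complex. cmod u < r \<longrightarrow>
           summable (log_zeta_term q G arev x0 u x) \<and>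
           cmeasure_integrable (spectral_measure (verts G) E x0 x)
             (\<lambda>s. Ln (1 - (of_nat q + 1 - of_real s) * u + of_nat q * u\<^sup>2)) \<and>
           - log_zeta q G arev x0 u x =
             cmeasure_integral (spectral_measure (verts G) E x0 x)
               (\<lambda>s. Ln (1 - (of_nat q + 1 - of_real s) * u + of_nat q * u\<^sup>2))"
proof -
  let ?V = "verts G" and ?T = "laplacian q G" and ?a = "of_nat q + 1 :: complex"
    and ?Q = "of_nat q :: complex"
  interpret bidirected_digraph G arev by (rule assms(2))
  interpret regular_bidirected_digraph G arev q
    by unfold_locales (rule assms(3))
  interpret l2_resolution ?V E
    using assms(7) by unfold_locales (simp add: spectral_resolution_def)
  have T: "cmeasure_integrable (\<lambda>B. l2_inner ?V (E B f) g) of_real"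
      "l2_inner ?V (?T f) g = cmeasure_integral (\<lambda>B. l2_inner ?V (E B f) g) of_real"
    if "f \<in> l2 ?V" "g \<in> l2 ?V" for f g
    using assms(7) that unfolding spectral_resolution_def by simp_all
  define g :: "'v \<Rightarrow> complex" where "g = indicator {x}"
  define F :: "nat \<Rightarrow> 'v \<Rightarrow> complex" where "F = (\<lambda>m v. of_int (geod_vec x0 m v))"
  have delta: "(indicator {y} :: 'v \<Rightarrow> complex) \<in> finsupp ?V" if "y \<in> ?V" for y
  proof -
    have "{v. (indicator {y} v :: complex) \<noteq> 0} = {y}" by (auto split: split_indicator)
    then show ?thesis using that by (simp add: finsupp_def)
  qed
  have g: "g \<in> finsupp ?V" unfolding g_def by (rule delta[OF assms(6)])
  have F: "F m \<in> finsupp ?V" for m unfolding F_def by (rule geod_vec_finsupp)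
  have F0: "F 0 = (\<lambda>v. 2 * indicator {x0} v + 0 * indicator {x0} v)"
    by (auto simp: F_def geod_vec_def geod_count_0[OF assms(5)] fun_eq_iff split: split_indicator)
  have laplacian_F: "?T (F m) = (\<lambda>v. ?a * F m v - of_int (\<Sum>e\<in>out_arcs G v. geod_vec x0 m (head G e)))" for m
    by (simp add: laplacian_def F_def)
  have F1: "?T (F 0) = (\<lambda>v. ?a * F 0 v - 2 * F 1 v)"
    unfolding laplacian_F geod_vec_1[symmetric] by (simp add: F_def)
  have F2: "?T (F (Suc m)) = (\<lambda>v. ?a * F (Suc m) v - (F (Suc (Suc m)) v + ?Q * F m v))" for m
    unfolding laplacian_F by (simp add: F_def geod_vec_Suc_Suc)
  obtain M h where M: "sets M = sets borel" and h: "integrable M h"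
    and \<mu>: "\<And>B. B \<in> sets borel \<Longrightarrow>
      l2_inner ?V (E B (indicator {x0})) g = (\<integral>s. indicator B s *\<^sub>R h s \<partial>M)"
    and null: "\<And>B. B \<in> sets borel \<Longrightarrow> (\<And>k. k \<in> l2 ?V \<Longrightarrow> l2_inner ?V (E B k) k = 0) \<Longrightarrow>
      B \<in> null_sets M"
    by (rule ex_density[OF delta[OF assms(5)] g]) blast
  \<comment> \<open>Any bound above the numerical bound \<open>2 (q + 1)\<close> would do.\<close>
  define K where "K = 2 * (real q + 1) + 1"
  have far: "D \<in> null_sets M" if D: "D \<in> sets borel" "\<And>s. s \<in> D \<Longrightarrow> K \<le> \<sigma> * s" and \<sigma>: "\<bar>\<sigma>\<bar> = 1" for D \<sigma>
  proof (rule null[OF D(1)])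
    fix k assume k: "k \<in> l2 ?V"
    show "l2_inner ?V (E D k) k = 0"
      by (rule E_outside_numerical_bound[OF T(1) T(2) laplacian_numerical_bound D \<sigma> _ k])
        (auto simp: K_def)
  qed
  have "{K..} \<in> null_sets M" by (rule far[of _ 1]) auto
  moreover have "{..-K} \<in> null_sets M" by (rule far[of _ "-1"]) auto
  ultimately have "AE s in M. s \<notin> {K..} \<and> s \<notin> {..-K}"
    by (intro AE_conjI AE_not_in)
  then have K: "AE s in M. \<bar>s\<bar> \<le> K"
    by eventually_elim auto
  have h\<phi>: "integrable M (\<lambda>s. \<phi> s * h s)" if "continuous_on UNIV \<phi>" for \<phi>
    by (rule integrable_continuous_mult[OF M h K that])
  have dens0: "has_spectral_density M g (indicator {x0}) h"
    using h \<mu> by (simp add: has_spectral_density_def)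
  have "has_spectral_density M g (F 0) (\<lambda>s. 2 * h s + 0 * h s)"
    unfolding F0 by (intro has_spectral_density_lincomb M delta assms(5) g dens0)
  then have dens: "has_spectral_density M g (F m) (\<lambda>s. lucas_V (?a - of_real s) ?Q m * h s)" for m
    by (intro lucas_V_spectral_density[OF T(2) F g M F1 F2] h\<phi>) auto
  have coeff: "of_int (geod_coeff q G arev x0 (Suc n) x) =
      (\<integral>s. lucas_V (?a - of_real s) ?Q (Suc n) * h s \<partial>M)" for n
  proof -
    have "complex_of_int (geod_coeff q G arev x0 (Suc n) x) = F (Suc n) x"
      by (simp add: F_def geod_vec_def)
    also have "\<dots> = l2_inner ?V (F (Suc n)) g"
      by (subst l2_inner_finsupp[OF g, of "{x}"]) (auto simp: g_def split: split_indicator)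
    also have "\<dots> = l2_inner ?V (E UNIV (F (Suc n))) g"
      by (simp add: E_UNIV finsupp_l2[OF F])
    also have "\<dots> = (\<integral>s. lucas_V (?a - of_real s) ?Q (Suc n) * h s \<partial>M)"
      using dens[of "Suc n"] unfolding has_spectral_density_def by simp
    finally show ?thesis .
  qed
  define L where "L = 1 + (K + cmod ?a) + cmod ?Q"
  have L_ge: "1 + (K + cmod ?a) + cmod ?Q \<le> L" by (simp add: L_def)
  have "0 \<le> K" by (simp add: K_def)
  then have L: "0 < L"
    unfolding L_def by (intro add_pos_nonneg add_nonneg_nonneg) auto
  show ?thesis
  proof (intro exI[of _ "1 / (2 * L)"] conjI allI impI)
    show "0 < 1 / (2 * L)" using L by simp
    fix u :: complex assume "cmod u < 1 / (2 * L)"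
    then have u: "2 * L * cmod u \<le> 1" using L by (simp add: field_simps)
    let ?\<phi> = "\<lambda>s. Ln (1 - (?a - of_real s) * u + ?Q * u\<^sup>2)"
    note main = integral_lucas_V_log_series[OF M h K L_ge u]
    have ser: "log_zeta_term q G arev x0 u x sums - (\<integral>s. h s * ?\<phi> s \<partial>M)"
      using main(2) unfolding coeff[symmetric] log_zeta_term_def[symmetric] .
    have \<mu>': "spectral_measure ?V E x0 x B = (\<integral>s. indicator B s *\<^sub>R h s \<partial>M)" if "B \<in> sets borel" for B
      using \<mu>[OF that] by (simp add: spectral_measure_def g_def)
    have [measurable]: "Ln \<in> borel_measurable borel" by (rule Ln_measurable)
    have \<phi>: "?\<phi> \<in> borel_measurable borel" by measurable
    show "summable (log_zeta_term q G arev x0 u x)"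
      using ser by (rule sums_summable)
    show "cmeasure_integrable (spectral_measure ?V E x0 x) ?\<phi>"
      by (rule cmeasure_integrable_density[OF M h \<mu>' \<phi> main(1)])
    have "cmeasure_integral (spectral_measure ?V E x0 x) ?\<phi> = (\<integral>s. h s * ?\<phi> s \<partial>M)"
      by (rule cmeasure_integral_density[OF M h \<mu>' \<phi> main(1)])
    moreover have "log_zeta q G arev x0 u x = - (\<integral>s. h s * ?\<phi> s \<partial>M)"
      unfolding log_zeta_def by (rule sums_unique[OF ser, symmetric])
    ultimately show "- log_zeta q G arev x0 u x = cmeasure_integral (spectral_measure ?V E x0 x) ?\<phi>"
      by (simp only: minus_minus)
  qed
qed

end
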